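(* The integer group determinants of $GA(1,27)$ are exactly the integers of the form $$D=AB^{26},\qquad A,B\in\mathbb Z,$$ where $B\equiv A\pmod{27}$ and $A$ satisfies: if $2\mid A$ then $4\mid A$, and if $13\mid A$ then $13^2\mid A$.
   Context: For a finite group $G=\{g_1,\dots,g_n\}$ and an element $\sum_{g\in G}a_g g$ of the group ring $\mathbb Z[G]$ (all $a_g\in\mathbb Z$), the group determinant is $D\left(\sum_{g\in G}a_g g\right)=\det\left(a_{g_ig_j^{-1}}\right)_{i,j=1}^n$. An integer group determinant of $G$ is any integer of this form. The general affine group of degree one over $\mathbb F_{27}$ is $GA(1,27)=\left\{\begin{pmatrix} a & b\\ 0 & 1\end{pmatrix}: a\in\mathbb F_{27}^*,\ b\in\mathbb F_{27}\right\}$ under matrix multiplication (a group of order $702$). *)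

theory Defs
  imports "HOL-Algebra.Group" "HOL-Combinatorics.Permutations" "HOL-Number_Theory.Cong"
begin

definition group_det :: "('g, 'm) monoid_scheme \<Rightarrow> ('g \<Rightarrow> int) \<Rightarrow> int" where
  "group_det G f =
     (\<Sum>p \<in> {p. p permutes carrier G}.
        sign p * (\<Prod>g \<in> carrier G. f (g \<otimes>\<^bsub>G\<^esub> inv\<^bsub>G\<^esub> (p g))))"

definition integer_group_determinants :: "('g, 'm) monoid_scheme \<Rightarrow> int set" where
  "integer_group_determinants G = {D. \<exists>f. D = group_det G f}"

text \<open>General affine group GA(1,F): the matrix (a b; 0 1) with a \<noteq> 0 is encoded
  as the pair (a,b); matrix multiplication gives (a,b)(c,d) = (ac, ad+b).\<close>
definition GA1 :: "('a::field \<times> 'a) monoid" where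
  "GA1 = \<lparr> carrier = {(a, b). a \<noteq> 0},
           monoid.mult = (\<lambda>(a, b) (c, d). (a * c, a * d + b)),
           monoid.one = (1, 0) \<rparr>"

end

theory Submission
  imports Defs Complex_Main "HOL-Computational_Algebra.Polynomial" "HOL-Computational_Algebra.Primes"
begin

text \<open>
  Decomposing the regular representation of \<open>G = F \<rtimes> F\<^sup>*\<close> along the additive characters of \<open>F\<close>
  gives \<open>D = A B\<^sup>2\<^sup>6\<close>, where \<open>A\<close> is the circulant determinant of order 26 of the projection to
  \<open>\<int>[F\<^sup>*]\<close> and \<open>B\<close> is the determinant of the representation of degree 26. The determinants at the 27
  characters are the Fourier transform of an integral function on \<open>F\<close> which are equal at all
  nontrivial characters; Fourier inversion then yields \<open>A - B = 27 c\<close> with \<open>c\<close> integral.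

  A circulant determinant of order 26 is a product of two of order 13 that are congruent
  modulo 2, and a circulant determinant of prime order \<open>p\<close> divisible by \<open>p\<close> is divisible by \<open>p\<^sup>2\<close>. This
  gives the conditions on \<open>A\<close>.

  Conversely, the kernel of \<open>\<int>[G] \<rightarrow> \<int>[F\<^sup>*]\<close> acts in degree 26 by all integral matrices
  divisible by 27. So for a circulant \<open>M\<close> of determinant \<open>A\<close> the value \<open>B\<close> may be the determinant of
  any matrix congruent to \<open>M\<close> modulo 27, and elimination modulo 27 shows that every
  \<open>B\<close> congruent to \<open>A\<close> occurs as soon as some maximal proper minor of \<open>M\<close> is prime to 3 after
  unimodular row and column operations. Suitable \<open>M\<close> come from cyclotomic units and from \<open>1 - x\<close>.
\<close>

section \<open>Determinants over finite index sets\<close>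

text \<open>The number \<open>B\<close> first appears as a complex determinant. Its integrality is
  not shown separately: the inversion formula yields \<open>A - B\<close> as 27 times an integer,
  and with it both integrality and the congruence. In the converse direction the prime 3 is the
  obstacle. Modulo \<open>27^2\<close>, \<open>det (M + 27 E)\<close> equals
  \<open>det M + 27 tr (adj M E)\<close>. If 3 divided all maximal proper minors of
  \<open>M\<close>, only the class of \<open>det M\<close> modulo 81 could be reached. Hence a
  circulant is needed whose determinant is exactly \<open>A\<close> and which has a minor of corank
  one prime to 3, also when 3 divides \<open>A\<close>. The values at roots of unity provide it: the
  determinant is the value at 1 times the product of the values elsewhere, and that product is such
  a minor after reduction. It is kept in the list 1, 2, -13, 26, while the value at 1 runs through a
  residue class modulo 26 and absorbs all powers of 3 in \<open>A\<close>.\<close>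

definition sdet :: "'i set \<Rightarrow> ('i \<Rightarrow> 'i \<Rightarrow> 'a::comm_ring_1) \<Rightarrow> 'a" where
  "sdet I m = (\<Sum>p | p permutes I. of_int (sign p) * (\<Prod>i\<in>I. m i (p i)))"

lemma sdet_cong:
  assumes "\<And>i j. i \<in> I \<Longrightarrow> j \<in> I \<Longrightarrow> m i j = m' i j"
  shows "sdet I m = sdet I m'"
  unfolding sdet_def
  by (intro sum.cong refl arg_cong2[where f = "(*)"] prod.cong)
     (auto simp: assms permutes_in_image)

lemma sdet_reindex:
  assumes h: "bij_betw h J I" and fin: "finite J"
  shows "sdet I m = sdet J (\<lambda>i j. m (h i) (h j))"
proof -
  let ?f = "\<lambda>\<pi> x. if x \<in> I then h (\<pi> (inv_into J h x)) else x"
  have eq: "?f p = map_permutation J h p" for p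
    using h by (auto simp: map_permutation_def restrict_id_def bij_betw_def fun_eq_iff)
  have bij: "bij_betw ?f {p. p permutes J} {p. p permutes I}"
    by (rule bij_betw_permutations[OF h])
  have "sdet I m = (\<Sum>p | p permutes J. of_int (sign (?f p)) * (\<Prod>i\<in>I. m i (?f p i)))"
    unfolding sdet_def by (rule sum.reindex_bij_betw[OF bij, symmetric])
  also have "\<dots> = sdet J (\<lambda>i j. m (h i) (h j))"
    unfolding sdet_def
  proof (rule sum.cong[OF refl])
    fix p assume p: "p \<in> {p. p permutes J}"
    have "sign (?f p) = sign p"
      unfolding eq using p h fin by (intro sign_map_permutation) (auto simp: bij_betw_def)
    moreover have "(\<Prod>i\<in>I. m i (?f p i)) = (\<Prod>i\<in>J. m (h i) (?f p (h i)))"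
      by (rule prod.reindex_bij_betw[OF h, symmetric])
    moreover have "(\<Prod>i\<in>J. m (h i) (?f p (h i))) = (\<Prod>i\<in>J. m (h i) (h (p i)))"
      using h by (intro prod.cong refl) (auto simp: bij_betw_def)
    ultimately show "of_int (sign (?f p)) * (\<Prod>i\<in>I. m i (?f p i))
        = of_int (sign p) * (\<Prod>i\<in>J. m (h i) (h (p i)))" by simp
  qed
  finally show ?thesis .
qed

lemma sdet_permute_rows:
  assumes fin: "finite I" and \<sigma>: "\<sigma> permutes I"
  shows "sdet I (\<lambda>i j. m (\<sigma> i) j) = of_int (sign \<sigma>) * sdet I m"
proof -
  have perm: "permutation p" if "p permutes I" for p
    using that fin permutation_permutes by blast
  have "sdet I (\<lambda>i j. m (\<sigma> i) j)
      = (\<Sum>p | p permutes I. of_int (sign (p \<circ> \<sigma>)) * (\<Prod>i\<in>I. m (\<sigma> i) ((p \<circ> \<sigma>) i)))"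
    unfolding sdet_def by (rule sum_permutations_compose_right[OF \<sigma>])
  also have "\<dots> = (\<Sum>p | p permutes I. of_int (sign \<sigma>) * (of_int (sign p) * (\<Prod>i\<in>I. m i (p i))))"
  proof (rule sum.cong[OF refl])
    fix p assume "p \<in> {p. p permutes I}"
    then have p: "p permutes I" by simp
    have "(\<Prod>i\<in>I. m (\<sigma> i) (p (\<sigma> i))) = (\<Prod>i\<in>I. m i (p i))"
      by (rule prod.reindex_bij_betw[OF permutes_imp_bij[OF \<sigma>]])
    then show "of_int (sign (p \<circ> \<sigma>)) * (\<Prod>i\<in>I. m (\<sigma> i) ((p \<circ> \<sigma>) i))
        = of_int (sign \<sigma>) * (of_int (sign p) * (\<Prod>i\<in>I. m i (p i)))"
      using perm[OF p] perm[OF \<sigma>] by (simp add: sign_compose)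
  qed
  finally show ?thesis by (simp add: sdet_def sum_distrib_left)
qed

lemma sdet_equal_rows:
  fixes m :: "'i \<Rightarrow> 'i \<Rightarrow> 'a::{idom, ring_char_0}"
  assumes fin: "finite I" and ij: "i \<in> I" "j \<in> I" "i \<noteq> j"
    and eq: "\<And>k. k \<in> I \<Longrightarrow> m i k = m j k"
  shows "sdet I m = 0"
proof -
  have "sdet I m = sdet I (\<lambda>k l. m (transpose i j k) l)"
    by (rule sdet_cong) (auto simp: transpose_def eq)
  also have "\<dots> = - sdet I m"
    using fin ij permutes_swap_id[OF ij(1,2)] by (simp add: sdet_permute_rows sign_swap_id)
  finally show ?thesis by simp
qed

lemma sdet_mult:
  fixes a b :: "'i \<Rightarrow> 'i \<Rightarrow> 'a::{idom, ring_char_0}"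
  assumes fin: "finite I"
  shows "sdet I (\<lambda>i j. \<Sum>k\<in>I. a i k * b k j) = sdet I a * sdet I b"
proof -
  let ?S = "\<lambda>f. (\<Prod>i\<in>I. a i (f i)) * sdet I (\<lambda>i j. b (f i) j)"
  have "sdet I (\<lambda>i j. \<Sum>k\<in>I. a i k * b k j)
      = (\<Sum>p | p permutes I. \<Sum>f\<in>I \<rightarrow>\<^sub>E I.
          of_int (sign p) * ((\<Prod>i\<in>I. a i (f i)) * (\<Prod>i\<in>I. b (f i) (p i))))"
    unfolding sdet_def using fin by (simp add: prod_sum_PiE sum_distrib_left prod.distrib)
  also have "\<dots> = (\<Sum>f\<in>I \<rightarrow>\<^sub>E I. ?S f)"
    unfolding sdet_def sum_distrib_left by (subst sum.swap) (simp add: mult_ac)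
  \<comment> \<open>A function that is not injective repeats a row of \<open>b\<close> and
    contributes 0. The others are permutations, restricted to \<open>I\<close> to be
    extensional.\<close>
  also have "\<dots> = (\<Sum>f\<in>(\<lambda>p. restrict p I) ` {p. p permutes I}. ?S f)"
  proof (rule sum.mono_neutral_right)
    show "finite (I \<rightarrow>\<^sub>E I)" using fin by (simp add: finite_PiE)
    show "(\<lambda>p. restrict p I) ` {p. p permutes I} \<subseteq> I \<rightarrow>\<^sub>E I"
      by (auto simp: permutes_in_image)
    show "\<forall>f\<in>(I \<rightarrow>\<^sub>E I) - (\<lambda>p. restrict p I) ` {p. p permutes I}. ?S f = 0"
    proof
      fix f assume f: "f \<in> (I \<rightarrow>\<^sub>E I) - (\<lambda>p. restrict p I) ` {p. p permutes I}"
      have "\<not> inj_on f I"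
      proof
        assume inj: "inj_on f I"
        let ?p = "\<lambda>x. if x \<in> I then f x else x"
        have "f ` I = I" using f inj fin by (intro endo_inj_surj) auto
        then have "bij_betw ?p I I" using inj by (auto simp: bij_betw_def inj_on_def)
        then have "?p permutes I" by (rule bij_imp_permutes) auto
        moreover have "f = restrict ?p I" using f by (auto simp: fun_eq_iff PiE_def extensional_def)
        ultimately show False using f by blast
      qed
      then obtain i j where ij: "i \<in> I" "j \<in> I" "i \<noteq> j" "f i = f j" by (auto simp: inj_on_def)
      have "sdet I (\<lambda>i j. b (f i) j) = 0"
        by (rule sdet_equal_rows[OF fin ij(1-3)]) (simp add: ij(4))
      then show "?S f = 0" by simp
    qed
  qed
  also have "\<dots> = (\<Sum>p | p permutes I. ?S (restrict p I))"
  proof (rule sum.reindex_cong[of "\<lambda>p. restrict p I"])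
    show "inj_on (\<lambda>p. restrict p I) {p. p permutes I}"
    proof (rule inj_onI)
      fix p q assume pq: "p \<in> {p. p permutes I}" "q \<in> {p. p permutes I}" "restrict p I = restrict q I"
      then have "p x = q x" for x
        by (cases "x \<in> I") (auto simp: permutes_not_in dest: fun_cong[of _ _ x])
      then show "p = q" by blast
    qed
  qed auto
  also have "\<dots> = (\<Sum>p | p permutes I. (\<Prod>i\<in>I. a i (p i)) * (of_int (sign p) * sdet I b))"
  proof (rule sum.cong[OF refl])
    fix p assume "p \<in> {p. p permutes I}"
    then have "sdet I (\<lambda>i j. b (p i) j) = of_int (sign p) * sdet I b"
      using fin by (simp add: sdet_permute_rows)
    moreover have "sdet I (\<lambda>i j. b (restrict p I i) j) = sdet I (\<lambda>i j. b (p i) j)"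
      by (rule sdet_cong) simp
    ultimately show "?S (restrict p I) = (\<Prod>i\<in>I. a i (p i)) * (of_int (sign p) * sdet I b)"
      by simp
  qed
  also have "\<dots> = sdet I a * sdet I b"
    unfolding sdet_def[of I a] sum_distrib_right by (simp add: mult_ac)
  finally show ?thesis .
qed

lemma of_int_sdet: "of_int (sdet I m) = sdet I (\<lambda>i j. of_int (m i j))"
  by (simp add: sdet_def)

lemma sdet_empty [simp]: "sdet {} m = 1"
  by (simp add: sdet_def)

text \<open>A permutation that moves \<open>j\<close> meets, in the row of its preimage of
  \<open>j\<close>, one of the zeros of column \<open>j\<close>. The row of \<open>j\<close> is
  arbitrary.\<close>

lemma sdet_pivot:
  assumes fin: "finite I" and j: "j \<notin> I" and z: "\<And>i. i \<in> I \<Longrightarrow> m i j = 0"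
  shows "sdet (insert j I) m = m j j * sdet I m"
proof -
  have "sdet (insert j I) m
      = (\<Sum>p | p permutes I. of_int (sign p) * (\<Prod>i\<in>insert j I. m i (p i)))"
    unfolding sdet_def
  proof (rule sum.mono_neutral_right)
    show "finite {p. p permutes insert j I}" using fin by (simp add: finite_permutations)
    show "{p. p permutes I} \<subseteq> {p. p permutes insert j I}"
      by (auto intro: permutes_subset)
    show "\<forall>p\<in>{p. p permutes insert j I} - {p. p permutes I}.
        of_int (sign p) * (\<Prod>i\<in>insert j I. m i (p i)) = 0"
    proof
      fix p assume p: "p \<in> {p. p permutes insert j I} - {p. p permutes I}"
      then have pj: "p permutes insert j I" and np: "\<not> p permutes I" by auto
      have "p j \<noteq> j"
      proof
        assume "p j = j"
        with pj have "p permutes I"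
          by (intro permutes_superset[OF pj]) auto
        with np show False by simp
      qed
      moreover obtain i where i: "p i = j" using pj by (metis permutes_surj surjD)
      ultimately have "i \<in> I" using pj
        by (metis insert_iff permutes_in_image)
      then have "m i (p i) = 0" using i z by simp
      then have "(\<Prod>i\<in>insert j I. m i (p i)) = 0"
        using \<open>i \<in> I\<close> fin by (intro prod_zero) auto
      then show "of_int (sign p) * (\<Prod>i\<in>insert j I. m i (p i)) = 0" by simp
    qed
  qed
  also have "\<dots> = m j j * sdet I m"
    unfolding sdet_def sum_distrib_left
    using fin j by (intro sum.cong refl) (auto simp: permutes_not_in mult_ac)
  finally show ?thesis .
qed

lemma sdet_identity_outside:
  assumes "finite I" "finite J" "I \<inter> J = {}"
  shows "sdet (I \<union> J) (\<lambda>i j. if i \<in> I \<and> j \<in> I then m i j else if i = j then 1 else 0) = sdet I m"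
  using assms(2,1,3)
proof (induction J)
  case empty
  then show ?case by (auto intro: sdet_cong)
next
  case (insert x J)
  have "I \<union> insert x J = insert x (I \<union> J)" by simp
  then show ?case using insert by simp (subst sdet_pivot, auto)
qed

lemma sdet_block:
  fixes m :: "'i \<Rightarrow> 'i \<Rightarrow> 'a::{idom, ring_char_0}"
  assumes fin: "finite I" "finite J" "I \<inter> J = {}"
    and z: "\<And>i j. i \<in> I \<Longrightarrow> j \<in> J \<Longrightarrow> m i j = 0" "\<And>i j. i \<in> J \<Longrightarrow> j \<in> I \<Longrightarrow> m i j = 0"
  shows "sdet (I \<union> J) m = sdet I m * sdet J m"
proof -
  let ?a = "\<lambda>i j. if i \<in> I \<and> j \<in> I then m i j else if i = j then 1 else 0"
  let ?b = "\<lambda>i j. if i \<in> J \<and> j \<in> J then m i j else if i = j then 1 else 0"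
  \<comment> \<open>The matrix is the product of its two blocks, each extended by the
    identity.\<close>
  have "sdet (I \<union> J) m = sdet (I \<union> J) (\<lambda>i j. \<Sum>k\<in>I \<union> J. ?a i k * ?b k j)"
  proof (rule sdet_cong)
    fix i j assume ij: "i \<in> I \<union> J" "j \<in> I \<union> J"
    have "(\<Sum>k\<in>I \<union> J. ?a i k * ?b k j) = (\<Sum>k\<in>{if i \<in> I then j else i}. ?a i k * ?b k j)"
      using ij fin z by (intro sum.mono_neutral_right) auto
    also have "\<dots> = m i j" using ij fin(3) z by auto
    finally show "m i j = (\<Sum>k\<in>I \<union> J. ?a i k * ?b k j)" by simp
  qed
  also have "\<dots> = sdet (I \<union> J) ?a * sdet (I \<union> J) ?b"
    using fin by (intro sdet_mult) simp
  also have "sdet (I \<union> J) ?a = sdet I m"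
    using fin by (rule sdet_identity_outside)
  also have "sdet (I \<union> J) ?b = sdet J m"
    using sdet_identity_outside[of J I m] fin by (simp add: Un_commute Int_commute)
  finally show ?thesis .
qed

lemma sdet_block_diag:
  fixes K :: "'z \<Rightarrow> 'x \<Rightarrow> 'x \<Rightarrow> 'a::{idom, ring_char_0}"
  assumes "finite Z" "finite X"
  shows "sdet (X \<times> Z) (\<lambda>(x, z) (y, w). if z = w then K z x y else 0) = (\<Prod>z\<in>Z. sdet X (K z))"
  using assms(1)
proof (induction Z)
  case empty
  then show ?case by simp
next
  case (insert z Z)
  let ?m = "\<lambda>(x, z) (y, w). if z = w then K z x y else 0"
  have "X \<times> insert z Z = X \<times> {z} \<union> X \<times> Z" by auto
  moreover have "sdet (X \<times> {z} \<union> X \<times> Z) ?m = sdet (X \<times> {z}) ?m * sdet (X \<times> Z) ?m"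
    by (rule sdet_block) (use insert assms in auto)
  moreover have "sdet (X \<times> {z}) ?m = sdet X (K z)"
    by (subst sdet_reindex[where h = "\<lambda>x. (x, z)" and J = X])
       (use assms in \<open>auto simp: bij_betw_def inj_on_def\<close>)
  ultimately show ?case using insert by simp
qed

lemma sdet_diag:
  assumes "finite I"
  shows "sdet I (\<lambda>i j. if i = j then d i else 0) = (\<Prod>i\<in>I. d i)"
  using assms
proof (induction I)
  case (insert x I)
  then show ?case by (subst sdet_pivot) auto
qed simp

text \<open>The inverse is allowed a scalar factor so that unnormalised Fourier matrices can be used.\<close>

lemma sdet_intertwine:
  fixes a b P Q :: "'i \<Rightarrow> 'i \<Rightarrow> 'a::{idom, ring_char_0}"
  assumes fin: "finite I" and c: "c \<noteq> 0"
    and inv: "\<And>i j. i \<in> I \<Longrightarrow> j \<in> I \<Longrightarrow> (\<Sum>k\<in>I. P i k * Q k j) = (if i = j then c else 0)"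
    and int: "\<And>i j. i \<in> I \<Longrightarrow> j \<in> I \<Longrightarrow> (\<Sum>k\<in>I. P i k * a k j) = (\<Sum>k\<in>I. b i k * P k j)"
  shows "sdet I a = sdet I b"
proof -
  have "sdet I P * sdet I Q = sdet I (\<lambda>i j. if i = j then c else 0)"
    unfolding sdet_mult[OF fin, symmetric] by (rule sdet_cong) (rule inv)
  also have "\<dots> = c ^ card I" using fin by (simp add: sdet_diag)
  finally have "sdet I P \<noteq> 0" using c by auto
  moreover have "sdet I P * sdet I a = sdet I b * sdet I P"
    unfolding sdet_mult[OF fin, symmetric] by (rule sdet_cong) (rule int)
  ultimately show ?thesis by simp
qed

text \<open>The hypothesis \<open>int\<close> expresses the effect of translation invariance in the
  second coordinate. Conjugation by the identity on \<open>X\<close> tensored with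
  \<open>\<chi>\<close> then splits \<open>M\<close> into the blocks \<open>K z\<close>. It serves
  the additive characters of a field and, with a one-point \<open>X\<close>, ordinary
  circulants.\<close>

lemma sdet_fourier:
  fixes \<chi> :: "'v \<Rightarrow> 'v \<Rightarrow> 'a::{idom, ring_char_0}"
  assumes fin: "finite X" "finite V" and c: "c \<noteq> 0"
    and orth: "\<And>z w. z \<in> V \<Longrightarrow> w \<in> V \<Longrightarrow> (\<Sum>b\<in>V. \<chi> z b * \<chi>' b w) = (if z = w then c else 0)"
    and int: "\<And>x y z d. x \<in> X \<Longrightarrow> y \<in> X \<Longrightarrow> z \<in> V \<Longrightarrow> d \<in> V \<Longrightarrow>
        (\<Sum>b\<in>V. \<chi> z b * M (x, b) (y, d)) = K z x y * \<chi> z d"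
  shows "sdet (X \<times> V) M = (\<Prod>z\<in>V. sdet X (K z))"
proof -
  have "sdet (X \<times> V) M = sdet (X \<times> V) (\<lambda>(x, z) (y, w). if z = w then K z x y else 0)"
  proof (rule sdet_intertwine[OF _ c])
    show "finite (X \<times> V)" using fin by simp
  next
    fix i j assume "i \<in> X \<times> V" "j \<in> X \<times> V"
    then obtain x z y w where *: "i = (x, z)" "j = (y, w)" "x \<in> X" "y \<in> X" "z \<in> V" "w \<in> V"
      by auto
    have "(\<Sum>k\<in>X \<times> V. (\<lambda>(x, z) (y, w). if x = y then \<chi> z w else 0) i k *
          (\<lambda>(x, z) (y, w). if x = y then \<chi>' z w else 0) k j)
        = (\<Sum>x'\<in>X. \<Sum>b\<in>V. if x' = x then if x = y then \<chi> z b * \<chi>' b w else 0 else 0)"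
      unfolding * sum.cartesian_product by (intro sum.cong) auto
    also have "\<dots> = (\<Sum>x'\<in>X. if x' = x then if x = y then (\<Sum>b\<in>V. \<chi> z b * \<chi>' b w) else 0 else 0)"
      by (intro sum.cong) auto
    also have "\<dots> = (if i = j then c else 0)"
      using * fin orth by auto
    finally show "(\<Sum>k\<in>X \<times> V. (\<lambda>(x, z) (y, w). if x = y then \<chi> z w else 0) i k *
          (\<lambda>(x, z) (y, w). if x = y then \<chi>' z w else 0) k j) = (if i = j then c else 0)" .
  next
    fix i j assume "i \<in> X \<times> V" "j \<in> X \<times> V"
    then obtain x z y d where *: "i = (x, z)" "j = (y, d)" "x \<in> X" "y \<in> X" "z \<in> V" "d \<in> V"
      by auto
    have "(\<Sum>k\<in>X \<times> V. (\<lambda>(x, z) (y, w). if x = y then \<chi> z w else 0) i k * M k j)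
        = (\<Sum>x'\<in>X. \<Sum>b\<in>V. if x' = x then \<chi> z b * M (x, b) (y, d) else 0)"
      unfolding * sum.cartesian_product by (intro sum.cong) auto
    also have "\<dots> = (\<Sum>x'\<in>X. if x' = x then (\<Sum>b\<in>V. \<chi> z b * M (x, b) (y, d)) else 0)"
      by (intro sum.cong) auto
    also have "\<dots> = K z x y * \<chi> z d" using * fin int by auto
    also have "\<dots> = (\<Sum>x'\<in>X. \<Sum>w\<in>V. if w = z then if x' = y then K z x y * \<chi> z d else 0 else 0)"
      using * fin by simp
    also have "\<dots> = (\<Sum>k\<in>X \<times> V. (\<lambda>(x, z) (y, w). if z = w then K z x y else 0) i k *
        (\<lambda>(x, z) (y, w). if x = y then \<chi> z w else 0) k j)"
      unfolding * sum.cartesian_product by (intro sum.cong) auto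
    finally show "(\<Sum>k\<in>X \<times> V. (\<lambda>(x, z) (y, w). if x = y then \<chi> z w else 0) i k * M k j)
      = (\<Sum>k\<in>X \<times> V. (\<lambda>(x, z) (y, w). if z = w then K z x y else 0) i k *
        (\<lambda>(x, z) (y, w). if x = y then \<chi> z w else 0) k j)" .
  qed
  also have "\<dots> = (\<Prod>z\<in>V. sdet X (K z))"
    using fin by (rule sdet_block_diag[rotated])
  finally show ?thesis .
qed

section \<open>Determinants of lifts modulo a prime power\<close>

text \<open>By \<open>sdet_cong_mod\<close> no lift can have a determinant outside this class, so
  the property is the best possible. It depends on \<open>m\<close> only modulo \<open>q\<close> and
  survives unimodular operations, which makes elimination available.\<close>

definition det_full :: "int \<Rightarrow> 'i set \<Rightarrow> ('i \<Rightarrow> 'i \<Rightarrow> int) \<Rightarrow> bool" where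
  "det_full q I m \<longleftrightarrow> (\<forall>B. [B = sdet I m] (mod q) \<longrightarrow>
     (\<exists>t. (\<forall>i\<in>I. \<forall>j\<in>I. [t i j = m i j] (mod q)) \<and> sdet I t = B))"

lemma det_fullI:
  assumes "\<And>B. [B = sdet I m] (mod q) \<Longrightarrow>
    \<exists>t. (\<forall>i\<in>I. \<forall>j\<in>I. [t i j = m i j] (mod q)) \<and> sdet I t = B"
  shows "det_full q I m"
  using assms unfolding det_full_def by simp

lemma det_fullE:
  assumes "det_full q I m" "[B = sdet I m] (mod q)"
  obtains t where "\<forall>i\<in>I. \<forall>j\<in>I. [t i j = m i j] (mod q)" "sdet I t = B"
  using assms unfolding det_full_def by blast

lemma sdet_cong_mod:
  assumes "\<And>i j. i \<in> I \<Longrightarrow> j \<in> I \<Longrightarrow> [m i j = m' i j] (mod q)"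
  shows "[sdet I m = sdet I m'] (mod q)"
  unfolding sdet_def
  by (intro cong_sum cong_mult cong_prod) (auto intro: assms simp: permutes_in_image)

lemma det_full_cong:
  assumes full: "det_full q I m'"
    and eq: "\<And>i j. i \<in> I \<Longrightarrow> j \<in> I \<Longrightarrow> [m i j = m' i j] (mod q)"
  shows "det_full q I m"
proof (rule det_fullI)
  fix B assume "[B = sdet I m] (mod q)"
  also have "[sdet I m = sdet I m'] (mod q)" by (rule sdet_cong_mod) (rule eq)
  finally have "[B = sdet I m'] (mod q)" .
  then obtain t where t: "\<forall>i\<in>I. \<forall>j\<in>I. [t i j = m' i j] (mod q)" "sdet I t = B"
    using full unfolding det_full_def by blast
  have "[t i j = m i j] (mod q)" if "i \<in> I" "j \<in> I" for i j
    using t(1) eq[OF that] that by (simp add: cong_def)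
  then show "\<exists>t. (\<forall>i\<in>I. \<forall>j\<in>I. [t i j = m i j] (mod q)) \<and> sdet I t = B"
    using t(2) by blast
qed

text \<open>A lift \<open>t\<close> of \<open>u m\<close> with determinant \<open>B\<close> is
  pulled back to the lift \<open>u' t\<close> of \<open>m\<close>, whose determinant is the
  same.\<close>

lemma det_full_mult_left:
  assumes fin: "finite I" and full: "det_full q I (\<lambda>i j. \<Sum>k\<in>I. u i k * m k j)"
    and inv: "\<And>i j. i \<in> I \<Longrightarrow> j \<in> I \<Longrightarrow> (\<Sum>k\<in>I. u' i k * u k j) = (if i = j then 1 else 0)"
    and u: "sdet I u = 1"
  shows "det_full q I m"
proof (rule det_fullI)
  fix B assume B: "[B = sdet I m] (mod q)"
  have "sdet I u' * sdet I u = sdet I (\<lambda>i j. if i = j then 1 else 0)"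
    unfolding sdet_mult[OF fin, symmetric] by (rule sdet_cong) (rule inv)
  then have u': "sdet I u' = 1" using u fin by (simp add: sdet_diag)
  from B have "[B = sdet I (\<lambda>i j. \<Sum>k\<in>I. u i k * m k j)] (mod q)"
    using u fin by (simp add: sdet_mult)
  from full this obtain t
    where t: "\<forall>i\<in>I. \<forall>j\<in>I. [t i j = (\<Sum>k\<in>I. u i k * m k j)] (mod q)"
      and tB: "sdet I t = B"
    by (rule det_fullE)
  let ?t = "\<lambda>i j. \<Sum>k\<in>I. u' i k * t k j"
  have "[?t i j = m i j] (mod q)" if ij: "i \<in> I" "j \<in> I" for i j
  proof -
    have "[?t i j = (\<Sum>k\<in>I. u' i k * (\<Sum>l\<in>I. u k l * m l j))] (mod q)"
      using ij t by (intro cong_sum cong_mult cong_refl) auto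
    also have "(\<Sum>k\<in>I. u' i k * (\<Sum>l\<in>I. u k l * m l j)) = (\<Sum>l\<in>I. (\<Sum>k\<in>I. u' i k * u k l) * m l j)"
      by (simp add: sum_distrib_left sum_distrib_right mult.assoc) (rule sum.swap)
    also have "\<dots> = (\<Sum>l\<in>I. if i = l then m l j else 0)"
      using ij by (intro sum.cong) (auto simp: inv)
    also have "\<dots> = m i j" using ij fin by simp
    finally show ?thesis .
  qed
  moreover have "sdet I ?t = B" using fin u' tB by (simp add: sdet_mult)
  ultimately show "\<exists>t. (\<forall>i\<in>I. \<forall>j\<in>I. [t i j = m i j] (mod q)) \<and> sdet I t = B"
    by (intro exI[of _ ?t] conjI ballI)
qed

lemma det_full_mult_right:
  assumes fin: "finite I" and full: "det_full q I (\<lambda>i j. \<Sum>k\<in>I. m i k * u k j)"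
    and inv: "\<And>i j. i \<in> I \<Longrightarrow> j \<in> I \<Longrightarrow> (\<Sum>k\<in>I. u i k * u' k j) = (if i = j then 1 else 0)"
    and u: "sdet I u = 1"
  shows "det_full q I m"
proof (rule det_fullI)
  fix B assume B: "[B = sdet I m] (mod q)"
  have "sdet I u * sdet I u' = sdet I (\<lambda>i j. if i = j then 1 else 0)"
    unfolding sdet_mult[OF fin, symmetric] by (rule sdet_cong) (rule inv)
  then have u': "sdet I u' = 1" using u fin by (simp add: sdet_diag)
  from B have "[B = sdet I (\<lambda>i j. \<Sum>k\<in>I. m i k * u k j)] (mod q)"
    using u fin by (simp add: sdet_mult)
  from full this obtain t
    where t: "\<forall>i\<in>I. \<forall>j\<in>I. [t i j = (\<Sum>k\<in>I. m i k * u k j)] (mod q)"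
      and tB: "sdet I t = B"
    by (rule det_fullE)
  let ?t = "\<lambda>i j. \<Sum>k\<in>I. t i k * u' k j"
  have "[?t i j = m i j] (mod q)" if ij: "i \<in> I" "j \<in> I" for i j
  proof -
    have "[?t i j = (\<Sum>k\<in>I. (\<Sum>l\<in>I. m i l * u l k) * u' k j)] (mod q)"
      using ij t by (intro cong_sum cong_mult cong_refl) auto
    also have "(\<Sum>k\<in>I. (\<Sum>l\<in>I. m i l * u l k) * u' k j) = (\<Sum>l\<in>I. m i l * (\<Sum>k\<in>I. u l k * u' k j))"
      by (simp add: sum_distrib_left sum_distrib_right mult.assoc) (rule sum.swap)
    also have "\<dots> = (\<Sum>l\<in>I. if l = j then m i l else 0)"
      using ij by (intro sum.cong) (auto simp: inv)
    also have "\<dots> = m i j" using ij fin by simp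
    finally show ?thesis .
  qed
  moreover have "sdet I ?t = B" using fin u' tB by (simp add: sdet_mult)
  ultimately show "\<exists>t. (\<forall>i\<in>I. \<forall>j\<in>I. [t i j = m i j] (mod q)) \<and> sdet I t = B"
    by (intro exI[of _ ?t] conjI ballI)
qed

text \<open>The identity with column \<open>a\<close> filled up off the diagonal. Multiplied from
  the left it adds multiples of row \<open>a\<close> to all other rows, from the right it adds
  multiples of all other columns to column \<open>a\<close>.\<close>

definition shear_col :: "'i \<Rightarrow> ('i \<Rightarrow> int) \<Rightarrow> 'i \<Rightarrow> 'i \<Rightarrow> int" where
  "shear_col a c i j = (if i = j then 1 else if j = a then c i else 0)"

lemma sum_two:
  fixes g :: "'i \<Rightarrow> 'b::comm_monoid_add"
  assumes "finite I" "a \<in> I" "i \<in> I" "a \<noteq> i" "\<And>k. k \<in> I \<Longrightarrow> k \<noteq> a \<Longrightarrow> k \<noteq> i \<Longrightarrow> g k = 0"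
  shows "sum g I = g a + g i"
proof -
  have "sum g I = sum g {a, i}" using assms by (intro sum.mono_neutral_right) auto
  then show ?thesis using assms by simp
qed

lemma shear_col_mult:
  assumes "finite I" "a \<in> I" "i \<in> I"
  shows "(\<Sum>k\<in>I. shear_col a c i k * m k j) = (if i = a then m a j else m i j + c i * m a j)"
proof (cases "i = a")
  case True
  then have "(\<Sum>k\<in>I. shear_col a c i k * m k j) = (\<Sum>k\<in>I. if k = a then m k j else 0)"
    by (intro sum.cong) (auto simp: shear_col_def)
  then show ?thesis using assms True by simp
next
  case False
  then show ?thesis
    by (subst sum_two[of _ a i]) (use assms in \<open>auto simp: shear_col_def\<close>)
qed

lemma shear_col_mult_right:
  assumes "finite I" "a \<in> I" "j \<in> I"
  shows "(\<Sum>k\<in>I. m i k * shear_col a c k j)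
    = (if j = a then m i a + (\<Sum>k\<in>I - {a}. c k * m i k) else m i j)"
proof (cases "j = a")
  case True
  have "(\<Sum>k\<in>I. m i k * shear_col a c k a)
      = m i a * shear_col a c a a + (\<Sum>k\<in>I - {a}. m i k * shear_col a c k a)"
    using assms by (intro sum.remove) auto
  also have "(\<Sum>k\<in>I - {a}. m i k * shear_col a c k a) = (\<Sum>k\<in>I - {a}. c k * m i k)"
    by (intro sum.cong) (auto simp: shear_col_def)
  finally show ?thesis using True by (simp add: shear_col_def)
next
  case False
  then have "(\<Sum>k\<in>I. m i k * shear_col a c k j) = (\<Sum>k\<in>I. if k = j then m i k else 0)"
    by (intro sum.cong) (auto simp: shear_col_def)
  then show ?thesis using assms False by simp
qed

lemma shear_col_inverse:
  assumes "finite I" "a \<in> I" "i \<in> I"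
  shows "(\<Sum>k\<in>I. shear_col a (\<lambda>x. - c x) i k * shear_col a c k j) = (if i = j then 1 else 0)"
  using assms by (subst shear_col_mult) (auto simp: shear_col_def)

text \<open>Every column except \<open>a\<close> is a unit vector, so these indices are pivoted away
  until only \<open>a\<close> is left.\<close>

lemma sdet_shear_col [simp]:
  assumes fin: "finite I" and a: "a \<in> I"
  shows "sdet I (shear_col a c) = 1"
  using fin a
proof (induction "card (I - {a})" arbitrary: I)
  case 0
  then have "I - {a} = {}" by (metis card_eq_0_iff finite_Diff)
  then have "I = {a}" using 0 by auto
  then show ?case by (auto simp: sdet_def shear_col_def)
next
  case (Suc n)
  then have "I - {a} \<noteq> {}" by (metis card.empty nat.simps(3))
  then obtain j where j: "j \<in> I" "j \<noteq> a" by auto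
  have "sdet (insert j (I - {j})) (shear_col a c) = shear_col a c j j * sdet (I - {j}) (shear_col a c)"
    using Suc j by (intro sdet_pivot) (auto simp: shear_col_def)
  also have "sdet (I - {j}) (shear_col a c) = 1"
  proof (rule Suc.hyps(1))
    have "I - {j} - {a} = I - {a} - {j}" by auto
    then show "n = card (I - {j} - {a})" using Suc.hyps(2) j Suc.prems by simp
  qed (use Suc j in auto)
  finally show ?case using j by (simp add: insert_absorb) (simp add: shear_col_def)
qed

lemma sdet_add_multiple_of_row:
  fixes m :: "'i \<Rightarrow> 'i \<Rightarrow> int"
  assumes fin: "finite I" and a: "a \<in> I"
  shows "sdet I (\<lambda>i j. if i = a then m a j else m i j + c i * m a j) = sdet I m"
proof -
  have "sdet I (\<lambda>i j. if i = a then m a j else m i j + c i * m a j)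
      = sdet I (\<lambda>i j. \<Sum>k\<in>I. shear_col a c i k * m k j)"
    using assms by (intro sdet_cong) (simp add: shear_col_mult)
  then show ?thesis using assms by (simp add: sdet_mult)
qed

lemma det_full_add_multiple_of_row:
  assumes fin: "finite I" and a: "a \<in> I"
    and full: "det_full q I (\<lambda>i j. if i = a then m a j else m i j + c i * m a j)"
  shows "det_full q I m"
proof (rule det_full_mult_left[where u = "shear_col a c" and u' = "shear_col a (\<lambda>x. - c x)"])
  show "det_full q I (\<lambda>i j. \<Sum>k\<in>I. shear_col a c i k * m k j)"
    using assms by (intro det_full_cong[OF full]) (simp add: shear_col_mult)
  show "(\<Sum>k\<in>I. shear_col a (\<lambda>x. - c x) i k * shear_col a c k j) = (if i = j then 1 else 0)"
    if "i \<in> I" "j \<in> I" for i j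
    using fin a that(1) by (rule shear_col_inverse)
qed (use assms in auto)

lemma sdet_two:
  assumes "a \<noteq> j"
  shows "sdet {a, j} m = m a a * m j j - m a j * m j a"
proof -
  have ne: "id \<noteq> transpose a j"
    using assms by (metis id_apply transpose_apply_first)
  have "{p. p permutes {a, j}} = {id, transpose a j}"
    by (auto simp: permutes_doubleton_iff)
  then show ?thesis
    unfolding sdet_def using assms ne by (simp add: sign_swap_id)
qed

text \<open>Let the rows be \<open>x, y\<close> and \<open>z, u\<close>. As \<open>q\<close> is
  invertible modulo \<open>u\<close>, \<open>y\<close> has a lift of the form
  \<open>1 + u * \<mu>\<close>. Adding \<open>q * \<delta> * \<mu>\<close> to \<open>x\<close> and
  \<open>q * \<delta>\<close> to \<open>z\<close> then changes the determinant by exactly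
  \<open>- q * \<delta>\<close>, so a suitable \<open>\<delta>\<close> hits the target.\<close>

lemma det_full_two:
  assumes aj: "a \<noteq> j" and cop: "coprime (m j j) q"
  shows "det_full q {a, j} m"
proof (rule det_fullI)
  fix B assume "[B = sdet {a, j} m] (mod q)"
  then obtain k where "B - (m a a * m j j - m a j * m j a) = q * k"
    unfolding sdet_two[OF aj] cong_iff_dvd_diff by (elim dvdE)
  then have k: "B = m a a * m j j - m a j * m j a + q * k" by simp
  let ?u = "m j j" and ?x = "m a a" and ?y = "m a j" and ?z = "m j a"
  obtain b where "[q * b = 1] (mod ?u)"
    using cong_solve_coprime_int[of q ?u] cop by (auto simp: coprime_commute)
  then obtain l where "q * b - 1 = ?u * l"
    unfolding cong_iff_dvd_diff by (elim dvdE)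
  then have l: "q * b = 1 + ?u * l" by simp
  define \<beta> where "\<beta> = b * (1 - ?y)"
  define \<mu> where "\<mu> = l * (1 - ?y)"
  have "q * \<beta> = (1 + ?u * l) * (1 - ?y)" by (simp add: \<beta>_def flip: l)
  then have \<mu>: "?y + q * \<beta> = 1 + ?u * \<mu>" by (simp add: \<mu>_def algebra_simps)
  define \<delta> where "\<delta> = - (k + \<beta> * ?z)"
  define t where "t = (\<lambda>i l. if i = a \<and> l = a then ?x + q * (\<delta> * \<mu>) else
      if i = a \<and> l = j then ?y + q * \<beta> else if i = j \<and> l = a then ?z + q * \<delta> else ?u)"
  have "sdet {a, j} t = (?x + q * (\<delta> * \<mu>)) * ?u - (?y + q * \<beta>) * (?z + q * \<delta>)"
    using aj by (simp add: sdet_two t_def)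
  also have "\<dots> = ?x * ?u + q * \<delta> * (?u * \<mu>) - (?y + q * \<beta>) * ?z - q * \<delta> * (?y + q * \<beta>)"
    by (simp add: algebra_simps)
  also have "?u * \<mu> = ?y + q * \<beta> - 1" using \<mu> by simp
  finally have "sdet {a, j} t = B" unfolding k \<delta>_def by (simp add: algebra_simps)
  moreover have "\<forall>i\<in>{a, j}. \<forall>l\<in>{a, j}. [t i l = m i l] (mod q)"
    using aj by (auto simp: t_def cong_def)
  ultimately show "\<exists>t. (\<forall>i\<in>{a, j}. \<forall>l\<in>{a, j}. [t i l = m i l] (mod q)) \<and> sdet {a, j} t = B"
    by blast
qed

lemma det_full_pivot:
  assumes fin: "finite J" and j: "j \<notin> J" and full: "det_full q J m"
    and one: "m j j = 1" and zero: "\<And>i. i \<in> J \<Longrightarrow> m i j = 0"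
  shows "det_full q (insert j J) m"
proof (rule det_fullI)
  fix B assume "[B = sdet (insert j J) m] (mod q)"
  then have "[B = sdet J m] (mod q)" using sdet_pivot[OF fin j, of m] one zero by simp
  then obtain t where t: "\<forall>i\<in>J. \<forall>k\<in>J. [t i k = m i k] (mod q)" "sdet J t = B"
    using full unfolding det_full_def by blast
  \<comment> \<open>The row and column of \<open>j\<close> are kept exactly, not just modulo
    \<open>q\<close>, so the pivot expansion also applies to the lift.\<close>
  define t' where "t' = (\<lambda>i k. if i = j \<or> k = j then m i k else t i k)"
  have "sdet (insert j J) t' = sdet J t'"
    using sdet_pivot[OF fin j, of t'] one zero j by (auto simp: t'_def)
  also have "\<dots> = B" unfolding t(2)[symmetric] using j by (intro sdet_cong) (auto simp: t'_def)
  finally have "sdet (insert j J) t' = B" .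
  moreover have "\<forall>i\<in>insert j J. \<forall>k\<in>insert j J. [t' i k = m i k] (mod q)"
    using t(1) by (auto simp: t'_def)
  ultimately show "\<exists>t. (\<forall>i\<in>insert j J. \<forall>k\<in>insert j J. [t i k = m i k] (mod q)) \<and> sdet (insert j J) t = B"
    by blast
qed

lemma prime_dvd_sdet_column:
  fixes p :: int
  assumes fin: "finite I" and j: "j \<in> I" and dvd: "\<And>i. i \<in> I \<Longrightarrow> p dvd m i j"
  shows "p dvd sdet I m"
  unfolding sdet_def
proof (rule dvd_sum)
  fix \<sigma> assume "\<sigma> \<in> {\<sigma>. \<sigma> permutes I}"
  then have s: "\<sigma> permutes I" by simp
  have "j \<in> \<sigma> ` I" using permutes_image[OF s] j by simp
  then obtain i where i: "i \<in> I" "\<sigma> i = j" by auto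
  have "p dvd m i (\<sigma> i)" using i dvd by simp
  also have "m i (\<sigma> i) dvd (\<Prod>i\<in>I. m i (\<sigma> i))" using fin i(1) by (rule dvd_prodI)
  finally show "p dvd of_int (sign \<sigma>) * (\<Prod>i\<in>I. m i (\<sigma> i))" by (rule dvd_mult)
qed

text \<open>Gaussian elimination over the local ring \<open>\<int>/q\<close>: a unit minor of corank one allows one to
  reduce to the two-by-two case without changing the determinant.\<close>

lemma det_full_of_minor:
  fixes p :: int
  assumes fin: "finite I" and ne: "I \<noteq> {}" and a: "a \<notin> I"
    and p: "prime p" and e: "e > 0" and minor: "\<not> p dvd sdet I m"
  shows "det_full (p ^ e) (insert a I) m"
  using fin ne a minor
proof (induction "card I" arbitrary: I m)
  case 0
  then show ?case by simp
next
  case (Suc n)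
  define q where "q = p ^ e"
  have cop: "coprime x q" if "\<not> p dvd x" for x
    using prime_imp_coprime[OF p that] unfolding q_def by (simp add: coprime_commute)
  show ?case
  proof (cases "n = 0")
    case True
    with Suc obtain j where I: "I = {j}" by (metis One_nat_def card_1_singletonE)
    with Suc have "\<not> p dvd m j j" by (simp add: sdet_def)
    then show ?thesis using det_full_two[of a j m] Suc I cop q_def by simp
  next
    case False
    obtain j where j: "j \<in> I" using Suc by auto
    have "card (I - {j}) \<noteq> 0" using Suc False j by simp
    then have "I - {j} \<noteq> {}" by (metis card.empty)
    then obtain k where k: "k \<in> I" "k \<noteq> j" by auto
    let ?J = "insert a I"
    have finJ: "finite ?J" using Suc by simp
    \<comment> \<open>A unit of column \<open>j\<close> outside row \<open>j\<close> is needed to turn the pivot into exactly 1.\<close>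
    have "\<exists>m1 i. (det_full q ?J m1 \<longrightarrow> det_full q ?J m) \<and> sdet I m1 = sdet I m
        \<and> i \<in> I \<and> i \<noteq> j \<and> \<not> p dvd m1 i j"
    proof (cases "\<exists>i\<in>I - {j}. \<not> p dvd m i j")
      case True
      then show ?thesis by blast
    next
      case False
      have jj: "\<not> p dvd m j j"
      proof
        assume "p dvd m j j"
        with False have "p dvd m i j" if "i \<in> I" for i using that by (cases "i = j") auto
        then have "p dvd sdet I m" by (intro prime_dvd_sdet_column[OF Suc.prems(1) j])
        then show False using Suc.prems by simp
      qed
      let ?c = "\<lambda>i. if i = k then 1 else 0 :: int"
      let ?m = "\<lambda>i l. if i = j then m j l else m i l + ?c i * m j l"
      have "det_full q ?J ?m \<longrightarrow> det_full q ?J m"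
        by (intro impI, rule det_full_add_multiple_of_row[of ?J j q m ?c]) (use finJ j in auto)
      moreover have "sdet I ?m = sdet I m"
        by (rule sdet_add_multiple_of_row[of I j m ?c]) (use Suc.prems j in auto)
      moreover have "\<not> p dvd ?m k j" using k jj False by (auto simp: dvd_add_right_iff)
      ultimately show ?thesis using k by (intro exI[of _ ?m] exI[of _ k] conjI)
    qed
    then obtain m1 i where m1: "det_full q ?J m1 \<Longrightarrow> det_full q ?J m" "sdet I m1 = sdet I m"
      and i: "i \<in> I" "i \<noteq> j" "\<not> p dvd m1 i j" by blast
    obtain b where "[m1 i j * b = 1] (mod q)" using cong_solve_coprime_int cop[OF i(3)] by blast
    then obtain s where "m1 i j * b - 1 = q * s"
      unfolding cong_iff_dvd_diff by (elim dvdE)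
    then have s: "m1 i j * b = 1 + q * s" by simp
    have "b * (1 - m1 j j) * m1 i j = (1 + q * s) * (1 - m1 j j)" by (simp flip: s)
    then have "m1 j j + b * (1 - m1 j j) * m1 i j = 1 + q * (s * (1 - m1 j j))"
      by (simp add: algebra_simps)
    then have b: "[m1 j j + b * (1 - m1 j j) * m1 i j = 1] (mod q)" by (simp add: cong_def)
    \<comment> \<open>Adding this multiple of row \<open>i\<close> to row \<open>j\<close> alone
      makes the entry at \<open>(j, j)\<close> congruent to 1.\<close>
    define c where "c = (\<lambda>l. if l = j then b * (1 - m1 j j) else 0)"
    define m2 where "m2 = (\<lambda>k l. if k = i then m1 i l else m1 k l + c k * m1 i l)"
    \<comment> \<open>The added row lies in \<open>I\<close>, so the operation respects both the
      whole matrix and the minor.\<close>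
    have m2: "det_full q ?J m2 \<Longrightarrow> det_full q ?J m1" "sdet I m2 = sdet I m1"
      unfolding m2_def
      by (rule det_full_add_multiple_of_row[of ?J i q m1 c], use finJ i in auto)
         (rule sdet_add_multiple_of_row[of I i m1 c], use Suc.prems i in auto)
    have m2jj: "[m2 j j = 1] (mod q)" using b i by (simp add: m2_def c_def)
    \<comment> \<open>The pivot may be set to 1 exactly, since lifts are compared modulo
      \<open>q\<close> only. The minor keeps its class modulo \<open>p\<close>.\<close>
    define m3 where "m3 = (\<lambda>k l. if k = j \<and> l = j then 1 else m2 k l)"
    have m23: "[m2 k l = m3 k l] (mod q)" for k l using m2jj by (auto simp: m3_def)
    \<comment> \<open>These multiples of row \<open>j\<close> clear column \<open>j\<close>,
      including its entry in row \<open>a\<close>.\<close>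
    define d where "d = (\<lambda>k. - m3 k j)"
    define m4 where "m4 = (\<lambda>k l. if k = j then m3 j l else m3 k l + d k * m3 j l)"
    have m4: "det_full q ?J m4 \<Longrightarrow> det_full q ?J m3" "sdet I m4 = sdet I m3"
      unfolding m4_def
      by (rule det_full_add_multiple_of_row[of ?J j q m3 d], use finJ j in auto)
         (rule sdet_add_multiple_of_row[of I j m3 d], use Suc.prems j in auto)
    have m4jj: "m4 j j = 1" and m4z: "k \<noteq> j \<Longrightarrow> m4 k j = 0" for k
      by (auto simp: m4_def m3_def d_def)
    have "sdet I m4 = sdet (I - {j}) m4"
      using sdet_pivot[of "I - {j}" j m4] Suc j m4jj m4z by (simp add: insert_absorb)
    moreover have "\<not> p dvd sdet I m4"
    proof -
      have "[sdet I m2 = sdet I m3] (mod q)" by (rule sdet_cong_mod) (rule m23)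
      moreover have "p dvd q" using e unfolding q_def by (simp add: dvd_power)
      ultimately have "[sdet I m2 = sdet I m3] (mod p)" by (rule cong_dvd_modulus)
      then show ?thesis using m4(2) m2(2) m1(2) Suc.prems(4) by (simp add: cong_dvd_iff)
    qed
    ultimately have minor': "\<not> p dvd sdet (I - {j}) m4" by simp
    have "det_full (p ^ e) (insert a (I - {j})) m4"
    proof (rule Suc.hyps(1))
      show "n = card (I - {j})" using Suc j by simp
      show "I - {j} \<noteq> {}" using k by blast
    qed (use Suc.prems minor' in auto)
    moreover have "j \<notin> insert a (I - {j})" using j Suc.prems by auto
    moreover have "insert j (insert a (I - {j})) = ?J" using j by auto
    moreover have "det_full q (insert j (insert a (I - {j}))) m4"
    proof (rule det_full_pivot)
      show "m4 i j = 0" if "i \<in> insert a (I - {j})" for i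
        using that \<open>j \<notin> insert a (I - {j})\<close> by (intro m4z) auto
    qed (use calculation Suc.prems(1) m4jj q_def in auto)
    ultimately have "det_full q ?J m4" by simp
    then have "det_full q ?J m3" by (rule m4(1))
    then have "det_full q ?J m2" by (rule det_full_cong) (rule m23)
    then show ?thesis unfolding q_def[symmetric] by (intro m1(1) m2(1))
  qed
qed

section \<open>Group determinants of the affine group of a finite field\<close>

text \<open>Every additive character of the field is \<open>\<psi>\<close> composed with
  multiplication by some \<open>z\<close>, so one nontrivial character carries the whole Fourier
  transform.\<close>

locale nontrivial_character =
  fixes \<psi> :: "'a::{field, finite} \<Rightarrow> complex" and q :: nat
  assumes card_UNIV [simp]: "card (UNIV :: 'a set) = q"
    and psi_add: "\<psi> (x + y) = \<psi> x * \<psi> y"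
    and psi_0 [simp]: "\<psi> 0 = 1"
    and psi_nontrivial: "\<exists>u. \<psi> u \<noteq> 1"
begin

abbreviation X :: "'a set" where "X \<equiv> UNIV - {0}"

lemma q_pos: "q > 0"
  using finite_UNIV_card_ge_0[where 'a = 'a] by simp

text \<open>Translation by \<open>u / z\<close> multiplies the sum by \<open>\<psi> u\<close>, which
  differs from 1.\<close>

lemma psi_sum: "(\<Sum>t\<in>UNIV. \<psi> (z * t)) = (if z = 0 then of_nat q else 0)"
proof (cases "z = 0")
  case False
  obtain u where u: "\<psi> u \<noteq> 1" using psi_nontrivial by blast
  let ?S = "\<Sum>t\<in>UNIV. \<psi> (z * t)"
  have "?S = (\<Sum>t\<in>UNIV. \<psi> (z * (t + u / z)))"
    by (rule sum.reindex_bij_witness[of _ "\<lambda>t. t + u / z" "\<lambda>t. t - u / z"]) auto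
  also have "\<dots> = \<psi> u * ?S"
    using False by (simp add: distrib_left psi_add sum_distrib_left mult.commute)
  finally have "(1 - \<psi> u) * ?S = 0" by (simp add: algebra_simps)
  then show ?thesis using u False by simp
qed simp

lemma psi_sum_nonzero: "(\<Sum>t\<in>X. \<psi> (z * t)) = (if z = 0 then of_nat q - 1 else - 1)"
proof -
  have "(\<Sum>t\<in>UNIV. \<psi> (z * t)) = \<psi> (z * 0) + (\<Sum>t\<in>X. \<psi> (z * t))"
    by (rule sum.remove) auto
  then have "(\<Sum>t\<in>X. \<psi> (z * t)) = (if z = 0 then of_nat q else 0) - 1"
    unfolding psi_sum by (simp add: algebra_simps)
  then show ?thesis by simp
qed

lemma psi_sum_nonzero_inverse: "(\<Sum>t\<in>X. \<psi> (z / t)) = (if z = 0 then of_nat q - 1 else - 1)"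
proof -
  have "(\<Sum>t\<in>X. \<psi> (z / t)) = (\<Sum>t\<in>X. \<psi> (z * t))"
    by (rule sum.reindex_bij_witness[of _ inverse inverse]) (auto simp: field_simps)
  then show ?thesis by (simp add: psi_sum_nonzero)
qed

text \<open>The image of the integral group ring of the additive group under the Fourier transform.
  It is a ring, so determinants over it stay in it; this is how integrality survives the passage to
  complex numbers.\<close>

definition integral_transforms :: "('a \<Rightarrow> complex) set" where
  "integral_transforms = {h. \<exists>c :: 'a \<Rightarrow> int. \<forall>z. h z = (\<Sum>t\<in>UNIV. \<psi> (z * t) * of_int (c t))}"

lemma integral_transforms_const: "(\<lambda>_. of_int k) \<in> integral_transforms"
  unfolding integral_transforms_def
proof (intro CollectI exI allI)
  fix z
  have "(\<Sum>t\<in>UNIV. \<psi> (z * t) * of_int (if t = 0 then k else 0))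
      = (\<Sum>t\<in>(UNIV :: 'a set). if t = 0 then of_int k else 0)"
    by (intro sum.cong) auto
  then show "(of_int k :: complex) = (\<Sum>t\<in>UNIV. \<psi> (z * t) * of_int (if t = 0 then k else 0))"
    by simp
qed

lemma integral_transforms_add:
  assumes "g \<in> integral_transforms" "h \<in> integral_transforms"
  shows "(\<lambda>z. g z + h z) \<in> integral_transforms"
proof -
  obtain c d :: "'a \<Rightarrow> int" where c: "\<And>z. g z = (\<Sum>t\<in>UNIV. \<psi> (z * t) * of_int (c t))"
    and d: "\<And>z. h z = (\<Sum>t\<in>UNIV. \<psi> (z * t) * of_int (d t))"
    using assms unfolding integral_transforms_def by blast
  have "\<forall>z. g z + h z = (\<Sum>t\<in>UNIV. \<psi> (z * t) * of_int (c t + d t))"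
    by (simp add: c d distrib_left sum.distrib)
  then show ?thesis unfolding integral_transforms_def by (intro CollectI exI)
qed

lemma integral_transforms_mult:
  assumes "g \<in> integral_transforms" "h \<in> integral_transforms"
  shows "(\<lambda>z. g z * h z) \<in> integral_transforms"
proof -
  obtain c d :: "'a \<Rightarrow> int" where c: "\<And>z. g z = (\<Sum>t\<in>UNIV. \<psi> (z * t) * of_int (c t))"
    and d: "\<And>z. h z = (\<Sum>t\<in>UNIV. \<psi> (z * t) * of_int (d t))"
    using assms unfolding integral_transforms_def by blast
  \<comment> \<open>The coefficients of the product are the convolution of \<open>c\<close> and
    \<open>d\<close>.\<close>
  have "g z * h z = (\<Sum>t\<in>UNIV. \<psi> (z * t) * of_int (\<Sum>s\<in>UNIV. c s * d (t - s)))" for z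
  proof -
    have "g z * h z = (\<Sum>s\<in>UNIV. \<Sum>t\<in>UNIV. \<psi> (z * s) * of_int (c s) * (\<psi> (z * t) * of_int (d t)))"
      unfolding c d by (rule sum_product)
    also have "\<dots> = (\<Sum>s\<in>UNIV. \<Sum>t\<in>UNIV. \<psi> (z * t) * of_int (c s * d (t - s)))"
    proof (rule sum.cong[OF refl])
      fix s
      have "(\<Sum>t\<in>UNIV. \<psi> (z * s) * of_int (c s) * (\<psi> (z * t) * of_int (d t)))
          = (\<Sum>t\<in>UNIV. \<psi> (z * s) * of_int (c s) * (\<psi> (z * (t - s)) * of_int (d (t - s))))"
        by (rule sum.reindex_bij_witness[of _ "\<lambda>t. t - s" "\<lambda>t. t + s"]) auto
      also have "\<dots> = (\<Sum>t\<in>UNIV. \<psi> (z * t) * of_int (c s * d (t - s)))"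
      proof (rule sum.cong[OF refl])
        fix t
        have "\<psi> (z * t) = \<psi> (z * s) * \<psi> (z * (t - s))"
          by (simp flip: psi_add distrib_left)
        then show "\<psi> (z * s) * of_int (c s) * (\<psi> (z * (t - s)) * of_int (d (t - s)))
            = \<psi> (z * t) * of_int (c s * d (t - s))" by simp
      qed
      finally show "(\<Sum>t\<in>UNIV. \<psi> (z * s) * of_int (c s) * (\<psi> (z * t) * of_int (d t)))
          = (\<Sum>t\<in>UNIV. \<psi> (z * t) * of_int (c s * d (t - s)))" .
    qed
    also have "\<dots> = (\<Sum>t\<in>UNIV. \<Sum>s\<in>UNIV. \<psi> (z * t) * of_int (c s * d (t - s)))"
      by (rule sum.swap)
    finally show ?thesis by (simp add: sum_distrib_left)
  qed
  then show ?thesis unfolding integral_transforms_def by (intro CollectI exI allI)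
qed

lemma integral_transforms_prod:
  assumes "\<And>i. i \<in> I \<Longrightarrow> g i \<in> integral_transforms"
  shows "(\<lambda>z. \<Prod>i\<in>I. g i z) \<in> integral_transforms"
  using assms
proof (induction I rule: infinite_finite_induct)
  case (insert i I)
  then show ?case using integral_transforms_mult[of "g i" "\<lambda>z. \<Prod>i\<in>I. g i z"] by simp
qed (use integral_transforms_const[of 1] in simp_all)

lemma integral_transforms_sum:
  assumes "\<And>i. i \<in> I \<Longrightarrow> g i \<in> integral_transforms"
  shows "(\<lambda>z. \<Sum>i\<in>I. g i z) \<in> integral_transforms"
  using assms
proof (induction I rule: infinite_finite_induct)
  case (insert i I)
  then show ?case using integral_transforms_add[of "g i" "\<lambda>z. \<Sum>i\<in>I. g i z"] by simp
qed (use integral_transforms_const[of 0] in simp_all)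

lemma integral_transforms_sdet:
  assumes "\<And>i j. i \<in> I \<Longrightarrow> j \<in> I \<Longrightarrow> (\<lambda>z. m z i j) \<in> integral_transforms"
  shows "(\<lambda>z. sdet I (m z)) \<in> integral_transforms"
  unfolding sdet_def
  by (intro integral_transforms_sum integral_transforms_mult[OF integral_transforms_const]
        integral_transforms_prod) (auto intro: assms simp: permutes_in_image)

text \<open>Fourier inversion at \<open>t = 1\<close>; this is the source of the congruence \<open>B = A\<close> modulo \<open>q\<close>.\<close>

lemma integral_transforms_difference:
  assumes h: "h \<in> integral_transforms" and const: "\<And>z. z \<noteq> 0 \<Longrightarrow> h z = b"
  obtains k :: int where "h 0 - b = of_nat q * of_int k"
proof -
  obtain c :: "'a \<Rightarrow> int" where c: "\<And>z. h z = (\<Sum>t\<in>UNIV. \<psi> (z * t) * of_int (c t))"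
    using h unfolding integral_transforms_def by blast
  have shift: "\<psi> (- z) * (\<psi> (z * t) * x) = x * \<psi> ((t - 1) * z)" for z t x
  proof -
    have "\<psi> ((t - 1) * z) = \<psi> (- z) * \<psi> (z * t)"
      by (simp add: algebra_simps flip: psi_add)
    then show ?thesis by (simp add: mult_ac)
  qed
  have "(\<Sum>z\<in>UNIV. \<psi> (- z) * h z) = (\<Sum>t\<in>UNIV. of_int (c t) * (\<Sum>z\<in>UNIV. \<psi> ((t - 1) * z)))"
    unfolding c sum_distrib_left shift by (rule sum.swap)
  also have "\<dots> = (\<Sum>t\<in>UNIV. if t = 1 then of_int (c t) * of_nat q else 0)"
    by (intro sum.cong) (auto simp: psi_sum)
  finally have "(\<Sum>z\<in>UNIV. \<psi> (- z) * h z) = of_nat q * of_int (c 1)" by (simp add: mult.commute)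
  moreover have "(\<Sum>z\<in>UNIV. \<psi> (- z) * h z) = h 0 + (\<Sum>z\<in>X. \<psi> (- z) * h z)"
    by (subst sum.remove[of UNIV 0]) auto
  \<comment> \<open>The values \<open>\<psi> (- z)\<close> at nonzero \<open>z\<close> sum to -1,
    which produces the difference \<open>h 0 - b\<close>; inversion at 0 would give
    \<open>h 0 + (q - 1) * b\<close> instead.\<close>
  moreover have "(\<Sum>z\<in>X. \<psi> (- z) * h z) = (\<Sum>z\<in>X. \<psi> (- 1 * z)) * b"
    unfolding sum_distrib_right by (intro sum.cong) (auto simp: const)
  ultimately have "h 0 - b = of_nat q * of_int (c 1)" by (simp only: psi_sum_nonzero) simp
  then show thesis by (rule that)
qed

text \<open>For \<open>z \<noteq> 0\<close> this is the matrix of \<open>f\<close> in the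
  representation of degree \<open>q - 1\<close> induced from the character
  \<open>\<psi> (z * _)\<close>: the element \<open>(h, b)\<close> sends the basis vector of
  \<open>c\<close> to that of \<open>h * c\<close>, with factor
  \<open>\<psi> (z * b / (h * c))\<close>. For \<open>z = 0\<close> only the quotient by the
  translations remains.\<close>

definition K :: "('a \<times> 'a \<Rightarrow> int) \<Rightarrow> 'a \<Rightarrow> 'a \<Rightarrow> 'a \<Rightarrow> complex" where
  "K f z a c = (\<Sum>t\<in>UNIV. \<psi> (z * t) * of_int (f (a / c, a * t)))"

text \<open>The nontrivial characters form one orbit under multiplication, and relabelling rows and
  columns by \<open>z\<close> carries one block to the other.\<close>

lemma sdet_K_scale:
  assumes "z \<noteq> 0"
  shows "sdet X (K f z) = sdet X (K f 1)"
proof -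
  have "bij_betw (\<lambda>x. z * x) X X"
    by (rule bij_betw_byWitness[where f' = "\<lambda>x. x / z"]) (use assms in auto)
  then have "sdet X (K f z) = sdet X (\<lambda>a c. K f z (z * a) (z * c))"
    by (rule sdet_reindex) simp
  also have "\<dots> = sdet X (K f 1)"
  proof (rule sdet_cong)
    fix a c assume "a \<in> X" "c \<in> X"
    then show "K f z (z * a) (z * c) = K f 1 a c"
      unfolding K_def
      by (intro sum.reindex_bij_witness[of _ "\<lambda>t. t / z" "\<lambda>t. z * t"])
         (use assms in \<open>auto simp: mult_ac\<close>)
  qed
  finally show ?thesis .
qed

lemma sdet_K_0: "sdet X (K f 0) = of_int (sdet X (\<lambda>a c. \<Sum>b\<in>UNIV. f (a / c, b)))"
  unfolding of_int_sdet
proof (rule sdet_cong)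
  fix a c assume "a \<in> X" "c \<in> X"
  then have "(\<Sum>t\<in>UNIV. of_int (f (a / c, a * t))) = (\<Sum>b\<in>UNIV. of_int (f (a / c, b)) :: complex)"
    by (intro sum.reindex_bij_witness[of _ "\<lambda>b. b / a" "\<lambda>t. a * t"]) auto
  then show "K f 0 a c = of_int (\<Sum>b\<in>UNIV. f (a / c, b))" by (simp add: K_def)
qed

text \<open>This gives at once that the complex number \<open>sdet X (K f 1)\<close> is an integer
  and in which class modulo \<open>q\<close> it lies.\<close>

lemma sdet_K_congruence:
  obtains k :: int where "sdet X (K f 1) = of_int (sdet X (\<lambda>a c. \<Sum>b\<in>UNIV. f (a / c, b)) - int q * k)"
proof -
  have "(\<lambda>z. sdet X (K f z)) \<in> integral_transforms"
    unfolding K_def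
    by (intro integral_transforms_sdet) (auto simp: integral_transforms_def)
  then obtain k :: int where "sdet X (K f 0) - sdet X (K f 1) = of_nat q * of_int k"
    using sdet_K_scale by (rule integral_transforms_difference)
  then have "sdet X (K f 1) = of_int (sdet X (\<lambda>a c. \<Sum>b\<in>UNIV. f (a / c, b)) - int q * k)"
    unfolding sdet_K_0 by (simp add: algebra_simps)
  then show thesis by (rule that)
qed

section \<open>The affine group and the factorization of its determinant\<close>

lemma GA1_group: "group (GA1 :: ('a \<times> 'a) monoid)"
proof (rule groupI)
  fix x assume "x \<in> carrier (GA1 :: ('a \<times> 'a) monoid)"
  then obtain a b where x: "x = (a, b)" "a \<noteq> 0" by (auto simp: GA1_def)
  then show "\<exists>y\<in>carrier GA1. y \<otimes>\<^bsub>GA1\<^esub> x = \<one>\<^bsub>GA1\<^esub>"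
    by (intro bexI[of _ "(inverse a, - b / a)"]) (auto simp: GA1_def divide_inverse)
qed (auto simp: GA1_def algebra_simps)

lemma GA1_mult_inv:
  fixes a b c d :: 'a
  assumes "a \<noteq> 0" "c \<noteq> 0"
  shows "(a, b) \<otimes>\<^bsub>GA1\<^esub> inv\<^bsub>GA1\<^esub> (c, d) = (a / c, b - a * d / c)"
proof -
  interpret group "GA1 :: ('a \<times> 'a) monoid" by (rule GA1_group)
  have "inv\<^bsub>GA1\<^esub> (c, d) = (inverse c, - d / c)"
    by (rule inv_equality) (use assms in \<open>auto simp: GA1_def divide_inverse\<close>)
  then show ?thesis by (simp add: GA1_def divide_inverse)
qed

text \<open>The coordinates \<open>(a, a * b)\<close> are chosen so that the entries depend on
  \<open>b\<close> and \<open>d\<close> only through \<open>b - d\<close>, as the Fourier transform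
  requires.\<close>

lemma group_det_GA1_eq_sdet:
  "group_det (GA1 :: ('a \<times> 'a) monoid) f = sdet (X \<times> UNIV) (\<lambda>(a, b) (c, d). f (a / c, a * (b - d)))"
proof -
  have "group_det GA1 f = sdet (carrier GA1) (\<lambda>g h. f (g \<otimes>\<^bsub>GA1\<^esub> inv\<^bsub>GA1\<^esub> h))"
    by (simp add: group_det_def sdet_def)
  also have "\<dots> = sdet (X \<times> UNIV) (\<lambda>(a, b) (c, d). f (a / c, a * (b - d)))"
  proof (subst sdet_reindex[where J = "X \<times> UNIV" and h = "\<lambda>(a, b). (a, a * b)"])
    show "bij_betw (\<lambda>(a, b). (a, a * b)) (X \<times> UNIV) (carrier (GA1 :: ('a \<times> 'a) monoid))"
      by (rule bij_betw_byWitness[where f' = "\<lambda>(a, b). (a, b / a)"]) (auto simp: GA1_def)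
    have "(a, a * b) \<otimes>\<^bsub>GA1\<^esub> inv\<^bsub>GA1\<^esub> (c, c * d) = (a / c, a * (b - d))"
      if "a \<noteq> 0" "c \<noteq> 0" for a b c d :: 'a
      using that by (simp add: GA1_mult_inv right_diff_distrib)
    note eq = this
    show "sdet (X \<times> UNIV) (\<lambda>i j. f ((case i of (a, b) \<Rightarrow> (a, a * b)) \<otimes>\<^bsub>GA1\<^esub>
        inv\<^bsub>GA1\<^esub> (case j of (a, b) \<Rightarrow> (a, a * b))))
      = sdet (X \<times> UNIV) (\<lambda>(a, b) (c, d). f (a / c, a * (b - d)))"
    proof (rule sdet_cong, elim SigmaE)
      fix i j :: "'a \<times> 'a" and a b c d
      assume "a \<in> X" "c \<in> X" "i = (a, b)" "j = (c, d)"
      then show "f ((case i of (a, b) \<Rightarrow> (a, a * b)) \<otimes>\<^bsub>GA1\<^esub> inv\<^bsub>GA1\<^esub> (case j of (a, b) \<Rightarrow> (a, a * b)))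
        = (\<lambda>(a, b) (c, d). f (a / c, a * (b - d))) i j"
        using eq[of a c b d] by simp
    qed
  qed simp
  finally show ?thesis .
qed

lemma of_int_group_det_GA1:
  "of_int (group_det (GA1 :: ('a \<times> 'a) monoid) f) = (\<Prod>z\<in>UNIV. sdet X (K f z))"
proof -
  let ?M = "\<lambda>i j. of_int ((\<lambda>(a, b) (c, d). f (a / c, a * (b - d))) i j) :: complex"
  have orth: "(\<Sum>b\<in>UNIV. \<psi> (z * b) * \<psi> (- (w * b))) = (if z = w then of_nat q else 0)" for z w :: 'a
  proof -
    have "(\<Sum>b\<in>UNIV. \<psi> (z * b) * \<psi> (- (w * b))) = (\<Sum>b\<in>UNIV. \<psi> ((z - w) * b))"
      by (simp add: left_diff_distrib flip: psi_add)
    then show ?thesis by (simp add: psi_sum)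
  qed
  have int: "(\<Sum>b\<in>UNIV. \<psi> (z * b) * ?M (x, b) (y, d)) = K f z x y * \<psi> (z * d)" for x y z d :: 'a
  proof -
    have "(\<Sum>b\<in>UNIV. \<psi> (z * b) * of_int (f (x / y, x * (b - d))))
        = (\<Sum>t\<in>UNIV. \<psi> (z * (t + d)) * of_int (f (x / y, x * t)))"
      by (rule sum.reindex_bij_witness[of _ "\<lambda>t. t + d" "\<lambda>b. b - d"]) auto
    also have "\<dots> = K f z x y * \<psi> (z * d)"
      unfolding K_def sum_distrib_right distrib_left psi_add by (rule sum.cong) simp_all
    finally show ?thesis by simp
  qed
  have "of_int (group_det (GA1 :: ('a \<times> 'a) monoid) f) = sdet (X \<times> UNIV) ?M"
    unfolding group_det_GA1_eq_sdet by (rule of_int_sdet)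
  also have "\<dots> = (\<Prod>z\<in>UNIV. sdet X (K f z))"
  proof (rule sdet_fourier[where X = X and V = UNIV and c = "of_nat q" and M = ?M and K = "K f"
        and \<chi> = "\<lambda>z b. \<psi> (z * b)" and \<chi>' = "\<lambda>b w. \<psi> (- (w * b))"])
    show "(\<Sum>b\<in>UNIV. \<psi> (z * b) * \<psi> (- (w * b))) = (if z = w then of_nat q else 0)" for z w
      by (rule orth)
    show "(\<Sum>b\<in>UNIV. \<psi> (z * b) * ?M (x, b) (y, d)) = K f z x y * \<psi> (z * d)" for x y z d
      by (rule int)
  qed (use q_pos in auto)
  finally show ?thesis .
qed

theorem group_det_GA1_factorization:
  assumes "of_int B = sdet X (K f 1)"
  shows "group_det (GA1 :: ('a \<times> 'a) monoid) f = sdet X (\<lambda>a c. \<Sum>b\<in>UNIV. f (a / c, b)) * B ^ (q - 1)"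
proof -
  have "of_int (group_det (GA1 :: ('a \<times> 'a) monoid) f) = sdet X (K f 0) * (\<Prod>z\<in>X. sdet X (K f z))"
    unfolding of_int_group_det_GA1 by (rule prod.remove) auto
  also have "(\<Prod>z\<in>X. sdet X (K f z)) = (\<Prod>z\<in>X. of_int B)"
  proof (rule prod.cong[OF refl])
    show "sdet X (K f z) = of_int B" if "z \<in> X" for z
      using that sdet_K_scale[of z f] assms by simp
  qed
  also have "sdet X (K f 0) * (\<Prod>z\<in>X. of_int B)
      = of_int (sdet X (\<lambda>a c. \<Sum>b\<in>UNIV. f (a / c, b)) * B ^ (q - 1))"
    unfolding prod_constant card_Diff_singleton[OF UNIV_I] card_UNIV
    by (simp only: sdet_K_0 of_int_mult of_int_power)
  finally show ?thesis by (simp only: of_int_eq_iff)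
qed

text \<open>In the basis of the nonzero points of the lattice \<open>\<int>\<^sup>F / \<int>(1,\<dots>,1)\<close>, the subgroup \<open>F\<^sup>*\<close> acts by
  permutations, and \<open>(1, c) H y\<close> with \<open>H\<close> the sum of \<open>F\<^sup>*\<close> and \<open>y\<close> in the augmentation ideal
  of \<open>\<int>[F]\<close> acts as \<open>q\<close> times a matrix supported in row \<open>c\<close>.\<close>

lemma realize_congruent_matrix:
  fixes g :: "'a \<Rightarrow> int" and E :: "'a \<Rightarrow> 'a \<Rightarrow> int"
  obtains f where "\<And>h. h \<noteq> 0 \<Longrightarrow> (\<Sum>b\<in>UNIV. f (h, b)) = g h"
    and "sdet X (K f 1) = of_int (sdet X (\<lambda>c d. g (c / d) + int q * E c d))"
proof -
  \<comment> \<open>The element \<open>y c\<close> is the sum of \<open>E c d\<close> times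
    \<open>[- d] - [0]\<close> over nonzero \<open>d\<close>; the value at 0 puts it into the
    augmentation ideal.\<close>
  define y where "y c b = (if b = 0 then - (\<Sum>d\<in>X. E c d) else E c (- b))" for c b
  \<comment> \<open>Since \<open>(1, c) (h, 0) (1, b) = (h, h * b + c)\<close>, the second summand
    collects the coefficients of \<open>(1, c) H (y c)\<close> over all \<open>c\<close>. The first
    summand is \<open>g\<close> on the elements \<open>(h, 0)\<close>.\<close>
  define f where "f = (\<lambda>(h, b). (if b = 0 then g h else 0) + (\<Sum>c\<in>X. y c ((b - c) / h)))"
  have y_sum: "(\<Sum>b\<in>UNIV. y c b) = 0" for c
  proof -
    have "(\<Sum>b\<in>UNIV. y c b) = y c 0 + (\<Sum>b\<in>X. y c b)" by (rule sum.remove) auto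
    also have "(\<Sum>b\<in>X. y c b) = (\<Sum>b\<in>X. E c b)"
      by (rule sum.reindex_bij_witness[of _ uminus uminus]) (auto simp: y_def)
    finally show ?thesis by (simp add: y_def)
  qed
  have f_sum: "(\<Sum>b\<in>UNIV. f (h, b)) = g h" if "h \<noteq> 0" for h
  proof -
    have "(\<Sum>b\<in>UNIV. y c ((b - c) / h)) = (\<Sum>b\<in>UNIV. y c b)" for c
      by (rule sum.reindex_bij_witness[of _ "\<lambda>b. h * b + c" "\<lambda>b. (b - c) / h"]) (use that in auto)
    then have "(\<Sum>b\<in>UNIV. \<Sum>c\<in>X. y c ((b - c) / h)) = 0"
      by (subst sum.swap) (simp add: y_sum)
    then show ?thesis by (simp add: f_def sum.distrib)
  qed
  have y_hat: "(\<Sum>b\<in>UNIV. \<psi> (b / v) * of_int (y c b)) = (\<Sum>d\<in>X. (\<psi> (- d / v) - 1) * of_int (E c d))" for c v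
  proof -
    have "(\<Sum>b\<in>UNIV. \<psi> (b / v) * of_int (y c b))
        = of_int (y c 0) + (\<Sum>b\<in>X. \<psi> (b / v) * of_int (y c b))"
      by (subst sum.remove[of UNIV 0]) auto
    also have "(\<Sum>b\<in>X. \<psi> (b / v) * of_int (y c b)) = (\<Sum>d\<in>X. \<psi> (- d / v) * of_int (E c d))"
      by (rule sum.reindex_bij_witness[of _ uminus uminus]) (auto simp: y_def)
    finally show ?thesis by (simp add: y_def left_diff_distrib sum_subtractf)
  qed
  have K_f: "K f 1 x v = of_int (g (x / v)) +
      (\<Sum>c\<in>X. \<psi> (c / x) * (\<Sum>d\<in>X. (\<psi> (- d / v) - 1) * of_int (E c d)))" if "x \<in> X" "v \<in> X" for x v
  proof -
    have "(\<Sum>t\<in>UNIV. \<psi> t * of_int (y c ((x * t - c) / (x / v))))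
        = \<psi> (c / x) * (\<Sum>b\<in>UNIV. \<psi> (b / v) * of_int (y c b))" for c
    proof -
      have "(\<Sum>t\<in>UNIV. \<psi> t * of_int (y c ((x * t - c) / (x / v))))
          = (\<Sum>b\<in>UNIV. \<psi> (b / v + c / x) * of_int (y c b))"
        by (rule sum.reindex_bij_witness[of _ "\<lambda>b. b / v + c / x" "\<lambda>t. (x * t - c) / (x / v)"])
           (use that in \<open>auto simp: field_simps\<close>)
      then show ?thesis by (simp add: psi_add sum_distrib_left mult_ac)
    qed
    note inner = this
    have "K f 1 x v = (\<Sum>t\<in>(UNIV :: 'a set). if t = 0 then of_int (g (x / v)) else 0)
        + (\<Sum>t\<in>UNIV. \<Sum>c\<in>X. \<psi> t * of_int (y c ((x * t - c) / (x / v))))"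
      unfolding K_def sum.distrib[symmetric]
      by (intro sum.cong) (use that in \<open>auto simp: f_def algebra_simps sum_distrib_left\<close>)
    also have "(\<Sum>t\<in>UNIV. \<Sum>c\<in>X. \<psi> t * of_int (y c ((x * t - c) / (x / v))))
        = (\<Sum>c\<in>X. \<psi> (c / x) * (\<Sum>b\<in>UNIV. \<psi> (b / v) * of_int (y c b)))"
      by (subst sum.swap) (simp only: inner)
    finally show ?thesis by (simp add: y_hat)
  qed
  let ?T = "\<lambda>c d. g (c / d) + int q * E c d"
  \<comment> \<open>The \<open>- 1\<close> in \<open>Q\<close> makes the summand vanish at
    \<open>c = 0\<close>, so orthogonality over the whole field holds on the nonzero points.\<close>
  have "sdet X (\<lambda>c d. of_int (?T c d)) = sdet X (K f 1)"
  proof (rule sdet_intertwine[where P = "\<lambda>x c. \<psi> (c / x)"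
        and Q = "\<lambda>c x. \<psi> (- c / x) - 1" and c = "of_nat q"])
    fix x v assume xv: "x \<in> X" "v \<in> X"
    show "(\<Sum>c\<in>X. \<psi> (c / x) * (\<psi> (- c / v) - 1)) = (if x = v then of_nat q else 0)"
    proof -
      have "(\<Sum>c\<in>X. \<psi> (c / x) * (\<psi> (- c / v) - 1))
          = (\<Sum>c\<in>X. \<psi> ((1 / x - 1 / v) * c)) - (\<Sum>c\<in>X. \<psi> ((1 / x) * c))"
        unfolding sum_subtractf[symmetric]
        by (intro sum.cong) (simp_all add: algebra_simps flip: psi_add)
      then show ?thesis using xv unfolding psi_sum_nonzero by simp
    qed
  next
    fix x e assume xe: "x \<in> X" "e \<in> X"
    \<comment> \<open>Substituting \<open>v = e * x / c\<close> turns \<open>x / v\<close> into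
      \<open>c / e\<close> and \<open>e / v\<close> into \<open>c / x\<close>.\<close>
    have 1: "(\<Sum>v\<in>X. of_int (g (x / v)) * \<psi> (e / v)) = (\<Sum>c\<in>X. \<psi> (c / x) * of_int (g (c / e)))"
      by (rule sum.reindex_bij_witness[of _ "\<lambda>c. e * x / c" "\<lambda>v. e * x / v"])
         (use xe in \<open>auto simp: field_simps\<close>)
    \<comment> \<open>\<open>Q\<close> inverts \<open>P\<close> up to \<open>q\<close> on this side
      too; this is the source of the factor \<open>q\<close> in front of \<open>E\<close>.\<close>
    have 2: "(\<Sum>v\<in>X. (\<psi> (- d / v) - 1) * \<psi> (e / v)) = (if d = e then of_nat q else 0)" if "d \<in> X" for d
    proof -
      have "(\<Sum>v\<in>X. (\<psi> (- d / v) - 1) * \<psi> (e / v)) = (\<Sum>v\<in>X. \<psi> ((e - d) / v)) - (\<Sum>v\<in>X. \<psi> (e / v))"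
        unfolding sum_subtractf[symmetric]
        by (intro sum.cong) (simp_all add: algebra_simps diff_divide_distrib flip: psi_add)
      then show ?thesis using xe unfolding psi_sum_nonzero_inverse by simp
    qed
    have "(\<Sum>v\<in>X. (\<Sum>c\<in>X. \<psi> (c / x) * (\<Sum>d\<in>X. (\<psi> (- d / v) - 1) * of_int (E c d))) * \<psi> (e / v))
        = (\<Sum>c\<in>X. \<psi> (c / x) * (\<Sum>d\<in>X. of_int (E c d) * (\<Sum>v\<in>X. (\<psi> (- d / v) - 1) * \<psi> (e / v))))"
    proof -
      have "(\<Sum>v\<in>X. (\<Sum>c\<in>X. \<psi> (c / x) * (\<Sum>d\<in>X. (\<psi> (- d / v) - 1) * of_int (E c d))) * \<psi> (e / v))
          = (\<Sum>v\<in>X. \<Sum>c\<in>X. \<psi> (c / x) * (\<Sum>d\<in>X. of_int (E c d) * ((\<psi> (- d / v) - 1) * \<psi> (e / v))))"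
        unfolding sum_distrib_left sum_distrib_right by (simp add: mult_ac)
      also have "\<dots> = (\<Sum>c\<in>X. \<Sum>v\<in>X. \<psi> (c / x) * (\<Sum>d\<in>X. of_int (E c d) * ((\<psi> (- d / v) - 1) * \<psi> (e / v))))"
        by (rule sum.swap)
      also have "\<dots> = (\<Sum>c\<in>X. \<psi> (c / x) * (\<Sum>v\<in>X. \<Sum>d\<in>X. of_int (E c d) * ((\<psi> (- d / v) - 1) * \<psi> (e / v))))"
        by (simp only: sum_distrib_left)
      also have "\<dots> = (\<Sum>c\<in>X. \<psi> (c / x) * (\<Sum>d\<in>X. \<Sum>v\<in>X. of_int (E c d) * ((\<psi> (- d / v) - 1) * \<psi> (e / v))))"
        by (subst (2) sum.swap) (rule refl)
      finally show ?thesis by (simp only: sum_distrib_left)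
    qed
    also have "\<dots> = (\<Sum>c\<in>X. \<psi> (c / x) * (\<Sum>d\<in>X. if d = e then of_int (E c d) * of_nat q else 0))"
      by (intro sum.cong arg_cong2[where f = "(*)"] refl) (simp only: 2, simp)
    also have "\<dots> = (\<Sum>c\<in>X. \<psi> (c / x) * (of_int (E c e) * of_nat q))"
      using xe by simp
    finally have 3: "(\<Sum>v\<in>X. (\<Sum>c\<in>X. \<psi> (c / x) * (\<Sum>d\<in>X. (\<psi> (- d / v) - 1) * of_int (E c d))) * \<psi> (e / v))
        = (\<Sum>c\<in>X. \<psi> (c / x) * (of_int (E c e) * of_nat q))" .
    have "(\<Sum>v\<in>X. K f 1 x v * \<psi> (e / v))
        = (\<Sum>c\<in>X. \<psi> (c / x) * of_int (g (c / e))) + (\<Sum>c\<in>X. \<psi> (c / x) * (of_int (E c e) * of_nat q))"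
      unfolding 1[symmetric] 3[symmetric] sum.distrib[symmetric]
      by (intro sum.cong refl) (simp only: K_f xe distrib_right)
    also have "\<dots> = (\<Sum>c\<in>X. \<psi> (c / x) * of_int (?T c e))"
      unfolding sum.distrib[symmetric] by (simp add: algebra_simps)
    finally show "(\<Sum>c\<in>X. \<psi> (c / x) * of_int (?T c e)) = (\<Sum>v\<in>X. K f 1 x v * \<psi> (e / v))" ..
  qed (use q_pos in auto)
  then have "sdet X (K f 1) = of_int (sdet X ?T)" by (simp only: of_int_sdet)
  with f_sum show thesis by (rule that)
qed

end

section \<open>The field with 27 elements: an additive character and a primitive root\<close>

lemma of_nat_card_UNIV: "of_nat (card (UNIV :: 'a::{ring_1, finite} set)) = (0 :: 'a)"
proof -
  have "(\<Sum>x\<in>(UNIV :: 'a set). x) = (\<Sum>x\<in>UNIV. x + 1)"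
    by (rule sum.reindex_bij_witness[of _ "\<lambda>x. x + 1" "\<lambda>x. x - 1"]) auto
  then show ?thesis by (simp add: sum.distrib)
qed

lemma power_card_field:
  fixes x :: "'a::{field, finite}"
  assumes "x \<noteq> 0"
  shows "x ^ (card (UNIV :: 'a set) - 1) = 1"
proof -
  let ?P = "\<Prod>y\<in>UNIV - {0 :: 'a}. y"
  have "?P = (\<Prod>y\<in>UNIV - {0}. x * y)"
    by (rule prod.reindex_bij_witness[of _ "\<lambda>y. x * y" "\<lambda>y. y / x"]) (use assms in auto)
  also have "\<dots> = x ^ card (UNIV - {0 :: 'a}) * ?P" by (simp add: prod.distrib)
  finally have "x ^ card (UNIV - {0 :: 'a}) = 1" by simp
  then show ?thesis by (simp add: card_Diff_singleton)
qed

context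
  assumes card27: "card (UNIV :: 'a::{field, finite} set) = 27"
begin

lemma three_eq_0: "(3 :: 'a) = 0"
proof -
  have "(3 :: 'a) ^ 3 = of_nat 27" by simp
  also have "\<dots> = 0" using of_nat_card_UNIV[where 'a = 'a] by (simp add: card27)
  finally show ?thesis using power_not_zero by blast
qed

lemma cube_add: "(x + y) ^ 3 = x ^ 3 + y ^ (3 :: nat)" for x y :: 'a
proof -
  have "(x + y) ^ 3 = x ^ 3 + y ^ 3 + 3 * (x\<^sup>2 * y + x * y\<^sup>2)"
    by (simp add: power2_eq_square power3_eq_cube algebra_simps)
  then show ?thesis by (simp add: three_eq_0)
qed

text \<open>The trace to the prime field, through which a character of the field with three elements
  becomes one of the large field.\<close>

definition trace27 :: "'a \<Rightarrow> 'a" where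
  "trace27 x = x + x ^ 3 + (x ^ 3) ^ 3"

lemma trace27_add: "trace27 (x + y) = trace27 x + trace27 y"
  by (simp add: trace27_def cube_add)

text \<open>As \<open>x ^ 27 = x\<close>, cubing permutes the three summands cyclically, so the
  trace is a root of \<open>X^3 - X\<close>.\<close>

lemma trace27_values: "trace27 x = 0 \<or> trace27 x = 1 \<or> trace27 x = - 1"
proof -
  have "((x ^ 3) ^ 3) ^ 3 = x"
  proof (cases "x = 0")
    case False
    then have "x ^ 26 = 1" using power_card_field[of x] by (simp add: card27)
    then have "x ^ 26 * x = x" by simp
    then show ?thesis by (simp flip: power_mult power_Suc2)
  qed simp
  then have "trace27 x ^ 3 = trace27 x" by (simp add: trace27_def cube_add)
  then have "trace27 x * ((trace27 x - 1) * (trace27 x + 1)) = 0"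
    by (simp add: power3_eq_cube algebra_simps)
  then show ?thesis by (auto simp: eq_neg_iff_add_eq_0)
qed

text \<open>A nonzero polynomial of degree at most 9 cannot vanish at 27 points.\<close>

lemma trace27_nonzero: "\<exists>x. trace27 x \<noteq> 0"
proof (rule ccontr)
  assume "\<nexists>x. trace27 x \<noteq> 0"
  let ?p = "monom 1 9 + (monom 1 3 + monom 1 1) :: 'a poly"
  have "poly ?p x = trace27 x" for x
    by (simp add: poly_monom trace27_def flip: power_mult)
  with \<open>\<nexists>x. trace27 x \<noteq> 0\<close> have "{x. poly ?p x = 0} = UNIV" by simp
  moreover have "coeff ?p 9 = 1" by simp
  then have "?p \<noteq> 0" by (metis coeff_0 zero_neq_one)
  then have "card {x. poly ?p x = 0} \<le> degree ?p" by (rule card_poly_roots_bound)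
  moreover have "degree ?p \<le> 9"
    by (intro degree_add_le) (auto intro: order_trans[OF degree_monom_le])
  ultimately show False by (simp add: card27)
qed

lemma nontrivial_character_exists: "\<exists>\<psi> :: 'a \<Rightarrow> complex. nontrivial_character \<psi> 27"
proof -
  define \<omega> where "\<omega> = Complex (- 1 / 2) (sqrt 3 / 2)"
  have \<omega>3: "\<omega> * (\<omega> * \<omega>) = 1" by (simp add: \<omega>_def complex_eq_iff field_simps)
  have \<omega>: "\<omega> \<noteq> 1" by (simp add: \<omega>_def complex_eq_iff)
  \<comment> \<open>Only the arguments 0, 1 and -1 occur; the last branch stands for -1.\<close>
  define e where "e t = (if t = 0 then 1 else if t = 1 then \<omega> else \<omega> * \<omega>)" for t :: 'a
  have two: "1 + 1 = (- 1 :: 'a)" "- 1 - 1 = (1 :: 'a)" "(1 :: 'a) \<noteq> - 1"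
  proof -
    have *: "(3 :: 'a) = 1 + 1 + 1" by simp
    then show "1 + 1 = (- 1 :: 'a)" using three_eq_0 by (simp only: eq_neg_iff_add_eq_0)
    then show "- 1 - 1 = (1 :: 'a)" by (metis add_diff_cancel_right' diff_minus_eq_add minus_minus)
    show "(1 :: 'a) \<noteq> - 1"
    proof
      assume "(1 :: 'a) = - 1"
      then have "1 + 1 = (0 :: 'a)" by (simp only: eq_neg_iff_add_eq_0)
      then have "(3 :: 'a) = 1" unfolding * by simp
      then show False using three_eq_0 by simp
    qed
  qed
  have e_add: "e (s + t) = e s * e t" if "s = 0 \<or> s = 1 \<or> s = - 1" "t = 0 \<or> t = 1 \<or> t = - 1" for s t
  proof -
    have "\<omega> * \<omega> * (\<omega> * \<omega>) = \<omega> * (\<omega> * (\<omega> * \<omega>))" by (simp add: mult_ac)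
    then have "\<omega> * \<omega> * (\<omega> * \<omega>) = \<omega>" using \<omega>3 by simp
    moreover have "\<omega> * \<omega> * \<omega> = 1" using \<omega>3 by (simp add: mult_ac)
    moreover have "e 0 = 1" "e 1 = \<omega>" by (simp_all add: e_def)
    moreover have "e (- 1) = \<omega> * \<omega>" using two(3)[symmetric] by (simp add: e_def)
    moreover have "(1 :: 'a) + - 1 = 0" "(- 1 :: 'a) + 1 = 0" "(- 1 :: 'a) + - 1 = 1"
      using two(2) by simp_all
    ultimately show ?thesis
      using that \<omega>3 by (elim disjE) (simp_all only: two(1) add_0_left add_0_right mult_1_left mult_1_right mult.assoc)
  qed
  have "nontrivial_character (\<lambda>x. e (trace27 x)) 27"
  proof
    obtain x where "trace27 x \<noteq> 0" using trace27_nonzero by blast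
    moreover have "trace27 (- x) = - trace27 x" by (simp add: trace27_def)
    ultimately have "trace27 x = 1 \<or> trace27 (- x) = 1"
      using trace27_values[of x] by auto
    then obtain u where "trace27 u = 1" by blast
    then show "\<exists>u. e (trace27 u) \<noteq> 1" using \<omega> by (intro exI[of _ u]) (simp add: e_def)
    show "e (trace27 (x + y)) = e (trace27 x) * e (trace27 y)" for x y
      unfolding trace27_add by (intro e_add trace27_values)
  qed (simp_all add: card27 e_def trace27_def)
  then show ?thesis by blast
qed

lemma power_gcd_eq_1:
  fixes x :: 'a
  assumes "x \<noteq> 0" "x ^ m = 1" "x ^ n = 1" "m \<noteq> 0"
  shows "x ^ gcd m n = 1"
proof -
  obtain a b where "m * a = n * b + gcd m n" using bezout_nat[OF assms(4)] by blast
  then have "(x ^ m) ^ a = (x ^ n) ^ b * x ^ gcd m n" by (simp flip: power_mult power_add)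
  then show ?thesis using assms by simp
qed

lemma card_power_roots: "card {x :: 'a. x ^ n = 1} \<le> n" if "n > 0"
proof -
  let ?p = "monom 1 n + [:- 1:] :: 'a poly"
  have "coeff ?p n = 1" using that by (cases n) auto
  then have "?p \<noteq> 0" by (metis coeff_0 zero_neq_one)
  then have "card {x. poly ?p x = 0} \<le> degree ?p" by (rule card_poly_roots_bound)
  also have "degree ?p \<le> n"
    by (intro degree_add_le) (auto intro: degree_monom_le)
  finally show ?thesis by (simp add: poly_monom)
qed

lemma dvd_26: "k dvd 2 \<or> k dvd 13" if "k dvd 26" "k < 26" for k :: nat
proof -
  have "prime (13 :: nat)" by simp
  show ?thesis
  proof (cases "13 dvd k")
    case True
    then obtain j where j: "k = 13 * j" ..
    with that have "j = 1" by (cases "j = 0") auto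
    with j show ?thesis by simp
  next
    case False
    then have "coprime k 13"
      using prime_imp_coprime[OF \<open>prime 13\<close>] coprime_commute by blast
    moreover have "k dvd 2 * 13" using that by simp
    ultimately show ?thesis using coprime_dvd_mult_left_iff by blast
  qed
qed

text \<open>At most 2 + 13 + 1 elements are roots of \<open>X^2 - 1\<close>, of
  \<open>X^13 - 1\<close>, or zero. Any other element has an order that divides 26 but neither 2 nor
  13.\<close>

lemma primitive_root_exists:
  obtains \<gamma> :: 'a where "\<gamma> \<noteq> 0" "\<gamma> ^ 26 = 1" "bij_betw (\<lambda>i. \<gamma> ^ i) {..<26} (UNIV - {0})"
proof -
  have "\<not> UNIV \<subseteq> {x :: 'a. x ^ 2 = 1} \<union> {x. x ^ 13 = 1} \<union> {0}"
  proof
    assume "UNIV \<subseteq> {x :: 'a. x ^ 2 = 1} \<union> {x. x ^ 13 = 1} \<union> {0}"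
    then have "card (UNIV :: 'a set) \<le> card ({x :: 'a. x ^ 2 = 1} \<union> {x. x ^ 13 = 1} \<union> {0})"
      by (intro card_mono) auto
    also have "\<dots> \<le> card {x :: 'a. x ^ 2 = 1} + card {x :: 'a. x ^ 13 = 1} + card {0 :: 'a}"
      by (meson add_mono card_Un_le order_refl order_trans)
    also have "\<dots> \<le> 2 + 13 + 1"
      by (intro add_mono card_power_roots) auto
    finally show False by (simp add: card27)
  qed
  then obtain \<gamma> :: 'a where \<gamma>: "\<gamma> ^ 2 \<noteq> 1" "\<gamma> ^ 13 \<noteq> 1" "\<gamma> \<noteq> 0" by auto
  have \<gamma>26: "\<gamma> ^ 26 = 1" using power_card_field[OF \<gamma>(3)] by (simp add: card27)
  have no: "\<gamma> ^ d \<noteq> 1" if "0 < d" "d < 26" for d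
  proof
    assume "\<gamma> ^ d = 1"
    then have g: "\<gamma> ^ gcd d 26 = 1" using \<gamma> \<gamma>26 that by (intro power_gcd_eq_1) auto
    have "gcd d 26 < 26" using gcd_le1_nat[of d 26] that by linarith
    then have "gcd d 26 dvd 2 \<or> gcd d 26 dvd 13" by (intro dvd_26) auto
    then show False
    proof
      assume "gcd d 26 dvd 2"
      then obtain k where "2 = gcd d 26 * k" ..
      then have "\<gamma> ^ 2 = (\<gamma> ^ gcd d 26) ^ k" by (simp flip: power_mult)
      then show False using g \<gamma> by simp
    next
      assume "gcd d 26 dvd 13"
      then obtain k where "13 = gcd d 26 * k" ..
      then have "\<gamma> ^ 13 = (\<gamma> ^ gcd d 26) ^ k" by (simp flip: power_mult)
      then show False using g \<gamma> by simp
    qed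
  qed
  have inj: "inj_on (\<lambda>i. \<gamma> ^ i) {..<26 :: nat}"
  proof (rule linorder_inj_onI)
    fix i j :: nat assume ij: "i < j" "i \<in> {..<26}" "j \<in> {..<26}"
    have "\<gamma> ^ j = \<gamma> ^ i * \<gamma> ^ (j - i)" using ij by (simp flip: power_add)
    then show "\<gamma> ^ i \<noteq> \<gamma> ^ j" using no[of "j - i"] ij \<gamma> by auto
  qed auto
  have "(\<lambda>i. \<gamma> ^ i) ` {..<26 :: nat} = UNIV - {0}"
    by (rule card_subset_eq) (use \<gamma> inj in \<open>auto simp: card_image card_Diff_singleton card27\<close>)
  then show thesis using \<gamma> \<gamma>26 inj by (intro that) (auto simp: bij_betw_def)
qed

end

section \<open>Circulants and roots of unity\<close>

text \<open>The residue of \<open>i - j\<close>; adding \<open>n - j\<close> avoids truncated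
  subtraction as long as \<open>j < n\<close>.\<close>

definition cyc_diff :: "nat \<Rightarrow> nat \<Rightarrow> nat \<Rightarrow> nat" where
  "cyc_diff n i j = (i + (n - j)) mod n"

definition circulant :: "nat \<Rightarrow> (nat \<Rightarrow> int) \<Rightarrow> nat \<Rightarrow> nat \<Rightarrow> int" where
  "circulant n c i j = c (cyc_diff n i j)"

definition circ_det :: "nat \<Rightarrow> (nat \<Rightarrow> int) \<Rightarrow> int" where
  "circ_det n c = sdet {..<n} (circulant n c)"

lemma cyc_diff_less [simp]: "n > 0 \<Longrightarrow> cyc_diff n i j < n"
  by (simp add: cyc_diff_def)

lemma int_cyc_diff:
  assumes "j < n"
  shows "int (cyc_diff n i j) = (int i - int j) mod int n"
proof -
  have "int (cyc_diff n i j) = ((int i - int j) + int n) mod int n"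
    using assms by (simp add: cyc_diff_def of_nat_mod of_nat_diff algebra_simps)
  then show ?thesis by simp
qed

lemma cyc_diff_cyc_diff:
  assumes "i < n" "j < n"
  shows "cyc_diff n i (cyc_diff n i j) = j"
proof -
  have "int (cyc_diff n i (cyc_diff n i j)) = int j"
    using assms by (simp add: int_cyc_diff mod_diff_right_eq)
  then show ?thesis by simp
qed

lemma sum_cyc_diff:
  assumes "i < n"
  shows "(\<Sum>j<n. F j (cyc_diff n i j)) = (\<Sum>t<n. F (cyc_diff n i t) t)"
  by (rule sum.reindex_bij_witness[of _ "cyc_diff n i" "cyc_diff n i"])
     (use assms in \<open>auto simp: cyc_diff_cyc_diff\<close>)

lemma sum_cyc_diff_left:
  assumes "j < n"
  shows "(\<Sum>i<n. F i (cyc_diff n i j)) = (\<Sum>t<n. F ((t + j) mod n) t)"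
proof (rule sum.reindex_bij_witness[of _ "\<lambda>t. (t + j) mod n" "\<lambda>i. cyc_diff n i j"])
  fix i assume "i \<in> {..<n}"
  then have "int ((cyc_diff n i j + j) mod n) = int i"
    using assms by (simp add: of_nat_mod int_cyc_diff mod_add_left_eq)
  then show "(cyc_diff n i j + j) mod n = i" by simp
  then show "F ((cyc_diff n i j + j) mod n) (cyc_diff n i j) = F i (cyc_diff n i j)" by simp
next
  fix t assume t: "t \<in> {..<n}"
  have "int (cyc_diff n ((t + j) mod n) j) = int t"
    using assms t by (simp add: of_nat_mod int_cyc_diff mod_diff_left_eq)
  then show "cyc_diff n ((t + j) mod n) j = t" by simp
qed (use assms in auto)

text \<open>This is the product of the values of the polynomial at the \<open>n\<close>-th roots of
  unity other than 1, see \<open>of_int_circ_minor\<close>. Adding a constant to all coefficients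
  does not change it.\<close>

definition circ_minor :: "nat \<Rightarrow> (nat \<Rightarrow> int) \<Rightarrow> int" where
  "circ_minor n c = sdet {1..<n} (\<lambda>i j. circulant n c i j - circulant n c 0 j)"

lemma circulant_row_sum: "i < n \<Longrightarrow> (\<Sum>j<n. circulant n c i j) = (\<Sum>t<n. c t)"
  unfolding circulant_def using sum_cyc_diff[of i n "\<lambda>_. c"] by simp

text \<open>Replacing column 0 by the sum of all columns and then subtracting row 0 from the other rows.\<close>

definition circulant_reduced :: "nat \<Rightarrow> (nat \<Rightarrow> int) \<Rightarrow> nat \<Rightarrow> nat \<Rightarrow> int" where
  "circulant_reduced n c i j =
     (let m = (\<lambda>i j. \<Sum>k<n. circulant n c i k * shear_col 0 (\<lambda>_. 1) k j)
      in if i = 0 then m 0 j else m i j + (- 1) * m 0 j)"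

lemma circulant_reduced:
  assumes "i < n" "j < n"
  shows "circulant_reduced n c i j = (if j = 0 then if i = 0 then \<Sum>t<n. c t else 0
    else if i = 0 then circulant n c 0 j else circulant n c i j - circulant n c 0 j)"
proof -
  have "(\<Sum>k<n. circulant n c i k * shear_col 0 (\<lambda>_. 1) k j)
      = (if j = 0 then \<Sum>t<n. c t else circulant n c i j)" if "i < n" for i
  proof -
    have "circulant n c i 0 + (\<Sum>k\<in>{..<n} - {0}. circulant n c i k) = (\<Sum>k<n. circulant n c i k)"
      using assms by (intro sum.remove[symmetric]) auto
    then show ?thesis
      using assms that by (subst shear_col_mult_right) (auto simp: circulant_row_sum)
  qed
  then show ?thesis using assms by (auto simp: circulant_reduced_def Let_def)
qed

lemma circ_det_eq: "n > 0 \<Longrightarrow> circ_det n c = (\<Sum>t<n. c t) * circ_minor n c"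
proof -
  assume n: "n > 0"
  have "circ_det n c = sdet {..<n} (\<lambda>i j. \<Sum>k<n. circulant n c i k * shear_col 0 (\<lambda>_. 1) k j)"
    unfolding circ_det_def using n by (simp add: sdet_mult)
  also have "\<dots> = sdet {..<n} (circulant_reduced n c)"
    unfolding circulant_reduced_def Let_def
    by (rule sdet_add_multiple_of_row[symmetric]) (use n in auto)
  also have "{..<n} = insert 0 {1..<n}" using n by auto
  also have "sdet (insert 0 {1..<n}) (circulant_reduced n c)
      = circulant_reduced n c 0 0 * sdet {1..<n} (circulant_reduced n c)"
    by (rule sdet_pivot) (auto simp: circulant_reduced)
  also have "sdet {1..<n} (circulant_reduced n c) = circ_minor n c"
    unfolding circ_minor_def by (rule sdet_cong) (auto simp: circulant_reduced)
  finally show ?thesis using n by (simp add: circulant_reduced)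
qed

text \<open>After reduction the index 0 plays the role of the extra index and
  \<open>circ_minor\<close> is the unit minor. The coefficient sum at \<open>(0, 0)\<close> may be
  divisible by \<open>p\<close>, which covers determinants divisible by \<open>p\<close>.\<close>

lemma det_full_circulant:
  assumes p: "prime p" and e: "e > 0" and n: "n > 1" and minor: "\<not> p dvd circ_minor n c"
  shows "det_full (p ^ e) {..<n} (circulant n c)"
proof (rule det_full_mult_right[where u = "shear_col 0 (\<lambda>_. 1)" and u' = "shear_col 0 (\<lambda>_. - 1)"])
  show "det_full (p ^ e) {..<n} (\<lambda>i j. \<Sum>k<n. circulant n c i k * shear_col 0 (\<lambda>_. 1) k j)"
  proof (rule det_full_add_multiple_of_row[where a = 0 and c = "\<lambda>_. - 1"])
    have "sdet {1..<n} (circulant_reduced n c) = circ_minor n c"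
      unfolding circ_minor_def by (rule sdet_cong) (auto simp: circulant_reduced)
    then have "det_full (p ^ e) (insert 0 {1..<n}) (circulant_reduced n c)"
      using p e n minor by (intro det_full_of_minor) auto
    also have "insert 0 {1..<n} = {..<n}" using n by auto
    finally show "det_full (p ^ e) {..<n} (\<lambda>i j. if i = 0
        then \<Sum>k<n. circulant n c 0 k * shear_col 0 (\<lambda>_. 1) k j
        else (\<Sum>k<n. circulant n c i k * shear_col 0 (\<lambda>_. 1) k j)
          + - 1 * (\<Sum>k<n. circulant n c 0 k * shear_col 0 (\<lambda>_. 1) k j))"
      unfolding circulant_reduced_def[abs_def] Let_def .
  qed (use n in auto)
  show "(\<Sum>k<n. shear_col 0 (\<lambda>_. 1) i k * shear_col 0 (\<lambda>_. - 1) k j) = (if i = j then 1 else 0)"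
    if "i \<in> {..<n}" "j \<in> {..<n}" for i j
    using shear_col_inverse[of "{..<n}" 0 i "\<lambda>_. - 1" j] that n by simp
qed (use n in auto)

text \<open>The combination of the columns with weights \<open>0, \<dots>, p - 1\<close> vanishes modulo \<open>p\<close>.\<close>

lemma prime_dvd_circ_minor:
  fixes p :: nat
  assumes p: "prime p" and dvd: "int p dvd (\<Sum>t<p. c t)"
  shows "int p dvd circ_minor p c"
proof -
  have p1: "p > 1" using p prime_gt_1_nat by blast
  let ?m = "\<lambda>i j. circulant p c i j - circulant p c 0 j"
  \<comment> \<open>If \<open>p\<close> divides the coefficient sum, the weighted sum of a row is
    the same modulo \<open>p\<close> for all rows and cancels against row 0.\<close>
  have weighted: "int p dvd (\<Sum>k<p. int k * circulant p c i k) - int i * (\<Sum>t<p. c t) + (\<Sum>t<p. int t * c t)"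
    if "i < p" for i
  proof -
    have "(\<Sum>k<p. int k * circulant p c i k) = (\<Sum>t<p. int (cyc_diff p i t) * c t)"
      unfolding circulant_def using sum_cyc_diff[OF that, of "\<lambda>j t. int j * c t"] by simp
    then have "(\<Sum>k<p. int k * circulant p c i k) - int i * (\<Sum>t<p. c t) + (\<Sum>t<p. int t * c t)
        = (\<Sum>t<p. (int (cyc_diff p i t) - (int i - int t)) * c t)"
      by (simp add: sum_distrib_left sum.distrib sum_subtractf algebra_simps)
    also have "int p dvd \<dots>"
    proof (intro dvd_sum dvd_mult2)
      fix t assume "t \<in> {..<p}"
      then show "int p dvd int (cyc_diff p i t) - (int i - int t)"
        by (simp add: int_cyc_diff mod_eq_dvd_iff[symmetric])
    qed
    finally show ?thesis .
  qed
  \<comment> \<open>Column 1 has weight 1 already, so the shear replaces it by the weighted sum of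
    all columns.\<close>
  have "circ_minor p c = sdet {1..<p} (\<lambda>i j. \<Sum>k\<in>{1..<p}. ?m i k * shear_col 1 int k j)"
    unfolding circ_minor_def using p1 by (simp add: sdet_mult)
  also have "int p dvd \<dots>"
  proof (rule prime_dvd_sdet_column[of _ 1])
    fix i assume i: "i \<in> {1..<p}"
    have "(\<Sum>k\<in>{1..<p}. ?m i k * shear_col 1 int k 1) = ?m i 1 + (\<Sum>k\<in>{1..<p} - {1}. int k * ?m i k)"
      using p1 by (subst shear_col_mult_right) auto
    also have "\<dots> = (\<Sum>k\<in>{1..<p}. int k * ?m i k)"
      using p1 by (subst sum.remove[of "{1..<p}" 1]) auto
    also have "\<dots> = (\<Sum>k<p. int k * ?m i k)"
      by (rule sum.mono_neutral_left) auto
    also have "\<dots> = (\<Sum>k<p. int k * circulant p c i k) - (\<Sum>k<p. int k * circulant p c 0 k)"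
      by (simp add: right_diff_distrib sum_subtractf)
    finally have eq: "(\<Sum>k\<in>{1..<p}. ?m i k * shear_col 1 int k 1) = \<dots>" .
    have "int p dvd ((\<Sum>k<p. int k * circulant p c i k) - int i * (\<Sum>t<p. c t) + (\<Sum>t<p. int t * c t))
        - ((\<Sum>k<p. int k * circulant p c 0 k) - int 0 * (\<Sum>t<p. c t) + (\<Sum>t<p. int t * c t))
        + int i * (\<Sum>t<p. c t)"
      using i p1 dvd by (intro dvd_add dvd_diff weighted dvd_mult) auto
    then show "int p dvd (\<Sum>k\<in>{1..<p}. ?m i k * shear_col 1 int k 1)"
      unfolding eq by (simp add: algebra_simps)
  qed (use p1 in auto)
  finally show ?thesis .
qed

section \<open>Values of integral polynomials at roots of unity\<close>

abbreviation roots_of_unity :: "nat \<Rightarrow> complex set" where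
  "roots_of_unity n \<equiv> {w. w ^ n = 1}"

lemma power_mod_eq: "w ^ n = 1 \<Longrightarrow> w ^ (k mod n) = w ^ k" for w :: "'a::monoid_mult"
  by (metis div_mult_mod_eq mult.commute mult_1 power_add power_mult power_one)

lemma sum_powers_root_of_unity:
  fixes w :: complex
  assumes "w ^ n = 1"
  shows "(\<Sum>t<n. w ^ t) = (if w = 1 then of_nat n else 0)"
proof (cases "w = 1")
  case False
  have "(1 - w) * (\<Sum>t<n. w ^ t) = 1 - w ^ n" by (rule one_diff_power_eq[symmetric])
  then show ?thesis using assms False by simp
qed simp

text \<open>The eigenvalues of a circulant are the values of its polynomial. The indices are paired
  with a one-point set to fit \<open>sdet_fourier\<close>.\<close>

lemma of_int_circ_det:
  assumes n: "n > 0"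
  shows "of_int (circ_det n c) = (\<Prod>w\<in>roots_of_unity n. \<Sum>t<n. of_int (c t) * w ^ t)"
proof -
  define \<zeta> where "\<zeta> z = cis (2 * pi * real z / real n)" for z
  have bij: "bij_betw \<zeta> {..<n} (roots_of_unity n)"
    unfolding \<zeta>_def using bij_betw_roots_unity[OF n] .
  then have \<zeta>n: "\<zeta> z ^ n = 1" if "z < n" for z using that by (auto simp: bij_betw_def)
  have \<zeta>0: "\<zeta> z \<noteq> 0" for z by (simp add: \<zeta>_def)
  let ?f = "\<lambda>w. \<Sum>t<n. of_int (c t) * w ^ t"
  let ?M = "\<lambda>i j. of_int (circulant n c (snd i) (snd j)) :: complex"
  have "of_int (circ_det n c) = sdet {..<n} (\<lambda>i j. of_int (circulant n c i j))"
    unfolding circ_det_def by (rule of_int_sdet)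
  also have "\<dots> = sdet ({()} \<times> {..<n}) ?M"
    by (rule sdet_reindex) (auto simp: bij_betw_def inj_on_def image_iff)
  also have "\<dots> = (\<Prod>z\<in>{..<n}. sdet {()} (\<lambda>_ _. ?f (\<zeta> z)))"
  proof (rule sdet_fourier[where X = "{()}" and V = "{..<n}" and c = "of_nat n" and M = ?M
        and K = "\<lambda>z _ _. ?f (\<zeta> z)" and \<chi> = "\<lambda>z b. \<zeta> z ^ b" and \<chi>' = "\<lambda>b w. inverse (\<zeta> w) ^ b"])
    fix z w assume zw: "z \<in> {..<n}" "w \<in> {..<n}"
    have "(\<Sum>b<n. \<zeta> z ^ b * inverse (\<zeta> w) ^ b) = (\<Sum>b<n. (\<zeta> z / \<zeta> w) ^ b)"
      by (simp add: divide_inverse power_mult_distrib)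
    also have "\<dots> = (if \<zeta> z / \<zeta> w = 1 then of_nat n else 0)"
      using zw \<zeta>n by (intro sum_powers_root_of_unity) (auto simp: power_divide)
    also have "\<zeta> z / \<zeta> w = 1 \<longleftrightarrow> z = w"
      using zw bij \<zeta>0 by (auto simp: bij_betw_def inj_on_def)
    finally show "(\<Sum>b<n. \<zeta> z ^ b * inverse (\<zeta> w) ^ b) = (if z = w then of_nat n else 0)" .
  next
    fix x y :: unit and z d assume z: "z \<in> {..<n}" and d: "d \<in> {..<n}"
    have "(\<Sum>b<n. \<zeta> z ^ b * of_int (c (cyc_diff n b d))) = (\<Sum>t<n. \<zeta> z ^ ((t + d) mod n) * of_int (c t))"
      using d by (intro sum_cyc_diff_left[of d n "\<lambda>b t. \<zeta> z ^ b * of_int (c t)"]) auto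
    also have "\<dots> = ?f (\<zeta> z) * \<zeta> z ^ d"
      unfolding sum_distrib_right using z \<zeta>n
      by (intro sum.cong) (auto simp: power_mod_eq power_add mult_ac)
    finally show "(\<Sum>b<n. \<zeta> z ^ b * ?M (x, b) (y, d)) = ?f (\<zeta> z) * \<zeta> z ^ d"
      by (simp add: circulant_def)
  qed (use n in auto)
  also have "\<dots> = (\<Prod>z<n. ?f (\<zeta> z))" by (simp add: sdet_def)
  also have "\<dots> = (\<Prod>w\<in>roots_of_unity n. ?f w)"
    by (rule prod.reindex_bij_betw[OF bij])
  finally show ?thesis .
qed

lemma finite_roots_of_unity [simp]: "n > 0 \<Longrightarrow> finite (roots_of_unity n)"
  using bij_betw_finite[OF bij_betw_roots_unity] by blast

lemma card_roots_of_unity: "n > 0 \<Longrightarrow> card (roots_of_unity n) = n"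
  using bij_betw_same_card[OF bij_betw_roots_unity] by simp

lemma of_int_circ_minor:
  assumes n: "n > 0"
  shows "of_int (circ_minor n c) = (\<Prod>w\<in>roots_of_unity n - {1}. \<Sum>t<n. of_int (c t) * w ^ t)"
proof -
  let ?f = "\<lambda>c w. \<Sum>t<n. of_int (c t :: int) * w ^ t :: complex"
  have key: "of_int (circ_minor n c) = (\<Prod>w\<in>roots_of_unity n - {1}. ?f c w)" if "(\<Sum>t<n. c t) \<noteq> 0" for c
  proof -
    have "of_int (circ_det n c) = ?f c 1 * (\<Prod>w\<in>roots_of_unity n - {1}. ?f c w)"
      unfolding of_int_circ_det[OF n] using n by (intro prod.remove) auto
    moreover have "?f c 1 = of_int (\<Sum>t<n. c t)" by simp
    ultimately have "of_int (\<Sum>t<n. c t) * of_int (circ_minor n c)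
        = of_int (\<Sum>t<n. c t) * (\<Prod>w\<in>roots_of_unity n - {1}. ?f c w)"
      unfolding circ_det_eq[OF n] of_int_mult by simp
    moreover have "of_int (\<Sum>t<n. c t) \<noteq> (0 :: complex)" using that by (simp del: of_int_sum)
    ultimately show ?thesis using mult_left_cancel by blast
  qed
  show ?thesis
  proof (cases "(\<Sum>t<n. c t) = 0")
    case True
    \<comment> \<open>Adding 1 to all coefficients changes neither side but makes the coefficient
      sum equal to \<open>n\<close>, which can be cancelled.\<close>
    let ?c = "\<lambda>t. c t + 1"
    have "circ_minor n c = circ_minor n ?c"
      unfolding circ_minor_def by (rule sdet_cong) (simp add: circulant_def)
    also have "of_int \<dots> = (\<Prod>w\<in>roots_of_unity n - {1}. ?f ?c w)"
      using True n by (intro key) (simp add: sum.distrib)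
    also have "\<dots> = (\<Prod>w\<in>roots_of_unity n - {1}. ?f c w)"
      by (intro prod.cong refl) (auto simp: distrib_right sum.distrib sum_powers_root_of_unity)
    finally show ?thesis .
  qed (rule key)
qed

text \<open>The product of the factors \<open>X - w\<close> divides
  \<open>1 + X + \<dots> + X^(n-1)\<close>; both are monic of degree \<open>n - 1\<close>, so they
  agree at 1.\<close>

lemma prod_roots_of_unity_linear:
  assumes n: "n > 0"
  shows "(\<Prod>w\<in>roots_of_unity n - {1}. 1 - w) = of_nat n"
proof -
  have dvd: "(\<Prod>w\<in>W. [:- w, 1:]) dvd monom 1 n - (1 :: complex poly)" if "W \<subseteq> roots_of_unity n" for W
  proof -
    have "finite W" using that n finite_subset finite_roots_of_unity by blast
    then show ?thesis using that
    proof (induction W)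
      case (insert w W)
      then obtain r where r: "monom 1 n - 1 = (\<Prod>w\<in>W. [:- w, 1:]) * r" by (auto elim: dvdE)
      have "poly (monom 1 n - 1) w = 0" using insert by (simp add: poly_monom)
      moreover have "poly (\<Prod>w\<in>W. [:- w, 1:]) w \<noteq> 0" using insert by (auto simp: poly_prod)
      ultimately have "poly r w = 0" unfolding r by simp
      then obtain s where "r = [:- w, 1:] * s" unfolding poly_eq_0_iff_dvd by (elim dvdE)
      moreover have "(\<Prod>w\<in>insert w W. [:- w, 1:]) = [:- w, 1:] * (\<Prod>w\<in>W. [:- w, 1:])"
        by (rule prod.insert[OF insert.hyps(1,2)])
      ultimately have "monom 1 n - 1 = (\<Prod>w\<in>insert w W. [:- w, 1:]) * s"
        unfolding r by (simp only: mult_ac)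
      then show ?case by (rule dvdI)
    qed simp
  qed
  let ?Q = "\<Prod>w\<in>roots_of_unity n - {1}. [:- w, 1 :: complex:]"
  let ?S = "\<Sum>i<n. monom 1 i :: complex poly"
  have "monom 1 n - 1 = [:- 1, 1:] * ?S"
    by (induction n) (auto simp: algebra_simps monom_Suc one_pCons)
  moreover have "(\<Prod>w\<in>roots_of_unity n. [:- w, 1:]) = [:- 1, 1:] * ?Q"
    using n by (intro prod.remove) auto
  ultimately have "[:- 1, 1:] * ?Q dvd [:- 1, 1:] * ?S" using dvd[of "roots_of_unity n"] by simp
  then have "?Q dvd ?S" unfolding dvd_mult_cancel_left by simp
  then obtain r where r: "?S = ?Q * r" by (elim dvdE)
  have lead: "lead_coeff ?Q = 1" by (simp add: lead_coeff_prod)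
  have degQ: "degree ?Q = n - 1"
    using n by (subst degree_prod_eq_sum_degree) (auto simp: card_Diff_singleton card_roots_of_unity)
  have S: "coeff ?S i = (if i < n then 1 else 0)" for i
    by (simp add: coeff_sum)
  have degS: "degree ?S \<le> n - 1" using S by (intro degree_le) auto
  have "?S \<noteq> 0" using S[of 0] n by (metis coeff_0 zero_neq_one)
  then have "degree ?S = degree ?Q + degree r" unfolding r by (intro degree_mult_eq) auto
  then have "degree r = 0" using degS degQ by simp
  then obtain a where a: "r = [:a:]" by (elim degree_eq_zeroE)
  have "a = coeff (?Q * r) (n - 1)" using lead unfolding a degQ by simp
  also have "\<dots> = 1" unfolding r[symmetric] S using n by simp
  finally have "poly ?S 1 = poly ?Q 1" unfolding r a by simp
  then show ?thesis by (simp add: poly_sum poly_monom poly_prod)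
qed

text \<open>This models \<open>\<int>[x] / (x^n - 1)\<close> by functions, of which only the values
  at the roots of unity count; exponents thus need no reduction.\<close>

definition root_polys :: "nat \<Rightarrow> (complex \<Rightarrow> complex) set" where
  "root_polys n = {f. \<exists>c :: nat \<Rightarrow> int. \<forall>w. w ^ n = 1 \<longrightarrow> f w = (\<Sum>t<n. of_int (c t) * w ^ t)}"

lemma root_polysI:
  assumes "\<And>w. w ^ n = 1 \<Longrightarrow> f w = (\<Sum>t<n. of_int (c t) * w ^ t)"
  shows "f \<in> root_polys n"
  using assms unfolding root_polys_def by blast

lemma root_polysE:
  assumes "f \<in> root_polys n"
  obtains c :: "nat \<Rightarrow> int" where "\<forall>w. w ^ n = 1 \<longrightarrow> f w = (\<Sum>t<n. of_int (c t) * w ^ t)"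
  using assms unfolding root_polys_def by blast

lemma root_polys_monom:
  assumes "n > 0"
  shows "(\<lambda>w. of_int k * w ^ m) \<in> root_polys n"
proof (rule root_polysI[where c = "\<lambda>t. if t = m mod n then k else 0"])
  fix w :: complex assume w: "w ^ n = 1"
  have "(\<Sum>t<n. of_int (if t = m mod n then k else 0) * w ^ t)
      = (\<Sum>t<n. if t = m mod n then of_int k * w ^ (m mod n) else 0)"
    by (intro sum.cong) auto
  also have "\<dots> = of_int k * w ^ m" using assms w by (simp add: power_mod_eq)
  finally show "of_int k * w ^ m = (\<Sum>t<n. of_int (if t = m mod n then k else 0) * w ^ t)" ..
qed

lemma root_polys_add:
  assumes "f \<in> root_polys n" "g \<in> root_polys n"
  shows "(\<lambda>w. f w + g w) \<in> root_polys n"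
proof -
  obtain c d :: "nat \<Rightarrow> int" where "\<forall>w. w ^ n = 1 \<longrightarrow> f w = (\<Sum>t<n. of_int (c t) * w ^ t)"
    "\<forall>w. w ^ n = 1 \<longrightarrow> g w = (\<Sum>t<n. of_int (d t) * w ^ t)"
    using assms by (elim root_polysE)
  then show ?thesis
    by (intro root_polysI[where c = "\<lambda>t. c t + d t"]) (simp add: distrib_right sum.distrib)
qed

lemma root_polys_sum:
  assumes "n > 0" "\<And>i. i \<in> I \<Longrightarrow> f i \<in> root_polys n"
  shows "(\<lambda>w. \<Sum>i\<in>I. f i w) \<in> root_polys n"
  using assms(2)
proof (induction I rule: infinite_finite_induct)
  case (insert i I)
  then show ?case using root_polys_add[of "f i" n "\<lambda>w. \<Sum>i\<in>I. f i w"] by simp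
qed (use root_polys_monom[OF assms(1), of 0 0] in simp_all)

lemma root_polys_mult:
  assumes n: "n > 0" and fg: "f \<in> root_polys n" "g \<in> root_polys n"
  shows "(\<lambda>w. f w * g w) \<in> root_polys n"
proof -
  obtain c d :: "nat \<Rightarrow> int" where cd: "\<forall>w. w ^ n = 1 \<longrightarrow> f w = (\<Sum>t<n. of_int (c t) * w ^ t)"
    "\<forall>w. w ^ n = 1 \<longrightarrow> g w = (\<Sum>t<n. of_int (d t) * w ^ t)"
    using fg by (elim root_polysE)
  have "(\<lambda>w. \<Sum>s<n. \<Sum>t<n. of_int (c s * d t) * w ^ (s + t)) \<in> root_polys n"
    using n by (intro root_polys_sum root_polys_monom)
  moreover have "f w * g w = (\<Sum>s<n. \<Sum>t<n. of_int (c s * d t) * w ^ (s + t))" if "w ^ n = 1" for w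
    unfolding cd[rule_format, OF that] sum_product by (simp add: power_add mult_ac)
  ultimately show ?thesis unfolding root_polys_def by auto
qed

lemma root_polys_power:
  assumes n: "n > 0" and f: "f \<in> root_polys n"
  shows "(\<lambda>w. f w ^ k) \<in> root_polys n"
proof (induction k)
  case (Suc k)
  then show ?case using root_polys_mult[OF n f] by simp
qed (use root_polys_monom[OF n, of 1 0] in simp)

lemma root_polys_freshman:
  assumes n: "n > 0" and p: "prime p" and fin: "finite I" and f: "\<And>i. i \<in> I \<Longrightarrow> f i \<in> root_polys n"
  obtains r where "r \<in> root_polys n" "\<And>w. (\<Sum>i\<in>I. f i w) ^ p = (\<Sum>i\<in>I. f i w ^ p) + of_nat p * r w"
proof -
  have "\<exists>r\<in>root_polys n. \<forall>w. (\<Sum>i\<in>I. f i w) ^ p = (\<Sum>i\<in>I. f i w ^ p) + of_nat p * r w"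
    using fin f
  proof (induction I)
    case empty
    then show ?case using root_polys_monom[OF n, of 0 0] prime_gt_0_nat[OF p]
      by (intro bexI[of _ "\<lambda>_. 0"]) auto
  next
    case (insert i I)
    then obtain r where r: "r \<in> root_polys n"
      "\<And>w. (\<Sum>i\<in>I. f i w) ^ p = (\<Sum>i\<in>I. f i w ^ p) + of_nat p * r w" by auto
    let ?g = "\<lambda>w. \<Sum>i\<in>I. f i w"
    \<comment> \<open>The mixed binomial terms divided by \<open>p\<close>; the factor
      \<open>w ^ 0\<close> gives the coefficient the shape of
      \<open>root_polys_monom\<close>.\<close>
    let ?b = "\<lambda>w. \<Sum>k\<in>{1..<p}. of_int (int ((p choose k) div p)) * w ^ 0 * (f i w ^ k * ?g w ^ (p - k))"
    have "(f i w + ?g w) ^ p = f i w ^ p + ?g w ^ p + of_nat p * ?b w" for w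
    proof -
      have "(f i w + ?g w) ^ p = (\<Sum>k\<le>p. of_nat (p choose k) * f i w ^ k * ?g w ^ (p - k))"
        by (rule binomial_ring)
      also have "{..p} = insert 0 (insert p {1..<p})" by auto
      also have "(\<Sum>k\<in>insert 0 (insert p {1..<p}). of_nat (p choose k) * f i w ^ k * ?g w ^ (p - k))
          = ?g w ^ p + (f i w ^ p + (\<Sum>k\<in>{1..<p}. of_nat (p choose k) * f i w ^ k * ?g w ^ (p - k)))"
        using prime_gt_0_nat[OF p] by (subst sum.insert, simp, simp, subst sum.insert) auto
      also have "(\<Sum>k\<in>{1..<p}. of_nat (p choose k) * f i w ^ k * ?g w ^ (p - k)) = of_nat p * ?b w"
        unfolding sum_distrib_left
      proof (intro sum.cong refl)
        fix k assume "k \<in> {1..<p}"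
        then have "p dvd (p choose k)" using p by (intro dvd_choose_prime) auto
        then have "p choose k = p * ((p choose k) div p)" by simp
        then have "(of_nat (p choose k) :: complex) = of_nat p * of_nat ((p choose k) div p)"
          by (metis of_nat_mult)
        then show "of_nat (p choose k) * f i w ^ k * ?g w ^ (p - k)
            = of_nat p * (of_int (int ((p choose k) div p)) * w ^ 0 * (f i w ^ k * ?g w ^ (p - k)))"
          by (simp add: mult_ac)
      qed
      finally show ?thesis by simp
    qed
    then have "(\<Sum>i\<in>insert i I. f i w) ^ p = (\<Sum>i\<in>insert i I. f i w ^ p) + of_nat p * (r w + ?b w)" for w
      using insert.hyps r(2)[of w] by (simp add: distrib_left)
    moreover have "(\<lambda>w. r w + ?b w) \<in> root_polys n"
      using n r(1) insert.prems
      by (intro root_polys_add root_polys_sum root_polys_mult root_polys_monom root_polys_power) auto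
    ultimately show ?case by (intro bexI[of _ "\<lambda>w. r w + ?b w"] allI)
  qed
  then show thesis using that by blast
qed

text \<open>If \<open>f\<close> is the polynomial of the circulant, then \<open>f(w)^p\<close> is the integer \<open>\<Sum> c\<^sub>t\<^sup>p\<close> plus \<open>p r(w)\<close> at every
  \<open>p\<close>-th root of unity \<open>w\<close>, with \<open>r\<close> an integral polynomial, so the \<open>p\<close>-th power of the determinant is that of a circulant which is
  scalar modulo \<open>p\<close>.\<close>

lemma prime_dvd_coeff_sum:
  fixes p :: nat
  assumes p: "prime p" and dvd: "int p dvd circ_det p c"
  shows "int p dvd (\<Sum>t<p. c t)"
proof -
  have p0: "p > 0" using p prime_gt_0_nat by blast
  have ip: "prime (int p)" using p by simp
  let ?f = "\<lambda>w. \<Sum>t<p. of_int (c t) * w ^ t :: complex"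
  let ?s = "\<Sum>t<p. c t ^ p"
  obtain r where r: "r \<in> root_polys p"
    and fr: "\<And>w. ?f w ^ p = (\<Sum>t<p. (of_int (c t) * w ^ t) ^ p) + of_nat p * r w"
  proof (rule root_polys_freshman[OF p0 p, of "{..<p}" "\<lambda>t w. of_int (c t) * w ^ t"])
    show "(\<lambda>w. of_int (c t) * w ^ t) \<in> root_polys p" for t by (rule root_polys_monom[OF p0])
  qed auto
  obtain d :: "nat \<Rightarrow> int" where "\<forall>w. w ^ p = 1 \<longrightarrow> r w = (\<Sum>t<p. of_int (d t) * w ^ t)"
    using r by (elim root_polysE)
  then have d: "r w = (\<Sum>t<p. of_int (d t) * w ^ t)" if "w ^ p = 1" for w using that by blast
  \<comment> \<open>The coefficients of the \<open>p\<close>-th power of the polynomial; modulo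
    \<open>p\<close> only the one at 0 survives.\<close>
  define e where "e t = (if t = 0 then ?s else 0) + int p * d t" for t
  have f_pow: "?f w ^ p = (\<Sum>t<p. of_int (e t) * w ^ t)" if w: "w ^ p = 1" for w
  proof -
    have "(\<Sum>t<p. (of_int (c t) * w ^ t) ^ p) = of_int ?s"
    proof -
      have "(w ^ t) ^ p = 1" for t
        unfolding power_mult[symmetric] mult.commute[of t] unfolding power_mult w by simp
      then show ?thesis by (simp add: power_mult_distrib)
    qed
    moreover have "(\<Sum>t<p. of_int (e t) * w ^ t)
        = (\<Sum>t<p. (if t = 0 then of_int ?s else 0) + of_nat p * (of_int (d t) * w ^ t))"
      by (intro sum.cong) (auto simp: e_def distrib_right simp del: of_int_sum)
    then have "(\<Sum>t<p. of_int (e t) * w ^ t) = of_int ?s + of_nat p * r w"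
      using p0 unfolding d[OF w] sum.distrib sum_distrib_left[symmetric] by simp
    ultimately show ?thesis unfolding fr by simp
  qed
  have "of_int (circ_det p c ^ p) = (\<Prod>w\<in>roots_of_unity p. ?f w ^ p)"
    unfolding of_int_power of_int_circ_det[OF p0] by (rule prod_power_distrib)
  also have "\<dots> = (\<Prod>w\<in>roots_of_unity p. \<Sum>t<p. of_int (e t) * w ^ t)"
    by (intro prod.cong refl) (simp add: f_pow)
  also have "\<dots> = of_int (circ_det p e)" by (simp add: of_int_circ_det[OF p0])
  finally have pow: "circ_det p c ^ p = circ_det p e" by (simp only: of_int_eq_iff)
  have diff0: "cyc_diff p i j = 0 \<longleftrightarrow> i = j" if "i < p" "j < p" for i j
    using that cyc_diff_cyc_diff[of i p j] by (auto simp: cyc_diff_def)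
  have "[circ_det p e = sdet {..<p} (\<lambda>i j. if i = j then ?s else 0)] (mod int p)"
    unfolding circ_det_def circulant_def
    by (rule sdet_cong_mod) (auto simp: e_def diff0 cong_def)
  also have "sdet {..<p} (\<lambda>i j. if i = j then ?s else 0) = ?s ^ p" by (simp add: sdet_diag)
  finally have "int p dvd ?s ^ p"
    using dvd p0 unfolding pow[symmetric] by (metis cong_dvd_iff dvd_power dvd_trans)
  then have s: "int p dvd ?s" using ip prime_dvd_power by blast
  \<comment> \<open>At \<open>w = 1\<close> the same identity leads from the sum of the
    \<open>p\<close>-th powers back to the \<open>p\<close>-th power of the sum.\<close>
  have "of_int ((\<Sum>t<p. c t) ^ p) = (of_int (\<Sum>t<p. e t) :: complex)"
    using f_pow[of 1] by simp
  then have "(\<Sum>t<p. c t) ^ p = (\<Sum>t<p. e t)" by (simp only: of_int_eq_iff)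
  also have "\<dots> = ?s + int p * (\<Sum>t<p. d t)"
    using p0 by (simp add: e_def sum.distrib sum_distrib_left)
  finally have "int p dvd (\<Sum>t<p. c t) ^ p" using s by simp
  then show ?thesis using ip prime_dvd_power by blast
qed

text \<open>The determinant is the coefficient sum times the minor, and \<open>p\<close> divides
  each of them.\<close>

lemma prime_square_dvd_circ_det:
  fixes p :: nat
  assumes p: "prime p" and dvd: "int p dvd circ_det p c"
  shows "(int p)\<^sup>2 dvd circ_det p c"
proof -
  have "int p dvd (\<Sum>t<p. c t)" using assms by (rule prime_dvd_coeff_sum)
  moreover from this have "int p dvd circ_minor p c" by (rule prime_dvd_circ_minor[OF p])
  ultimately show ?thesis
    unfolding power2_eq_square circ_det_eq[OF prime_gt_0_nat[OF p]] by (rule mult_dvd_mono)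
qed

section \<open>Circulants of order twice an odd number\<close>

lemma roots_of_unity_double:
  assumes "odd m"
  shows "roots_of_unity (2 * m) = roots_of_unity m \<union> uminus ` roots_of_unity m"
    and "roots_of_unity m \<inter> uminus ` roots_of_unity m = {}"
proof -
  have neg: "(- w) ^ m = - (w ^ m)" for w :: complex using assms by simp
  have "w ^ (2 * m) = 1 \<longleftrightarrow> w ^ m = 1 \<or> (- w) ^ m = 1" for w :: complex
  proof -
    have "w ^ (2 * m) = (w ^ m)\<^sup>2" by (simp add: mult.commute[of 2] power_mult)
    moreover have "- (w ^ m) = 1 \<longleftrightarrow> w ^ m = - 1" by (rule minus_equation_iff[THEN trans]) auto
    ultimately show ?thesis unfolding neg by (simp add: power2_eq_1_iff)
  qed
  note roots = this
  have "w \<in> uminus ` roots_of_unity m \<longleftrightarrow> (- w) ^ m = 1" for w :: complex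
  proof
    assume "(- w) ^ m = 1"
    then have "- w \<in> roots_of_unity m" by simp
    then have "- (- w) \<in> uminus ` roots_of_unity m" by (rule imageI)
    then show "w \<in> uminus ` roots_of_unity m" by simp
  qed auto
  then show "roots_of_unity (2 * m) = roots_of_unity m \<union> uminus ` roots_of_unity m"
    using roots by blast
  show "roots_of_unity m \<inter> uminus ` roots_of_unity m = {}" using neg by auto
qed

lemma prod_roots_of_unity_double:
  assumes "odd m"
  shows "(\<Prod>w\<in>roots_of_unity (2 * m). f w) = (\<Prod>u\<in>roots_of_unity m. f u * f (- u))"
proof -
  have m: "m > 0" using assms by (cases m) auto
  have "(\<Prod>w\<in>roots_of_unity (2 * m). f w)
      = (\<Prod>u\<in>roots_of_unity m. f u) * (\<Prod>w\<in>uminus ` roots_of_unity m. f w)"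
    unfolding roots_of_unity_double(1)[OF assms]
    using m by (intro prod.union_disjoint roots_of_unity_double(2)[OF assms]) auto
  also have "(\<Prod>w\<in>uminus ` roots_of_unity m. f w) = (\<Prod>u\<in>roots_of_unity m. f (- u))"
    by (subst prod.reindex) (auto simp: inj_on_def)
  finally show ?thesis by (simp add: prod.distrib)
qed

lemma sum_lessThan_double: "(\<Sum>t<2 * m. g t) = (\<Sum>t<m. g t + g (t + m))" for g :: "nat \<Rightarrow> 'a::comm_monoid_add"
proof -
  have "(\<Sum>t<2 * m. g t) = (\<Sum>t<m. g t) + (\<Sum>t\<in>{m..<2 * m}. g t)"
    by (subst sum.union_disjoint[symmetric]) (auto intro!: sum.cong)
  also have "(\<Sum>t\<in>{m..<2 * m}. g t) = (\<Sum>t<m. g (t + m))"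
    by (rule sum.reindex_bij_witness[of _ "\<lambda>t. t + m" "\<lambda>t. t - m"]) auto
  finally show ?thesis by (simp add: sum.distrib)
qed

text \<open>The polynomial is reduced modulo \<open>x^m - 1\<close> and modulo
  \<open>x^m + 1\<close>. As \<open>m\<close> is odd, replacing \<open>x\<close> by
  \<open>- x\<close> turns the second reduction into a circulant as well, at the cost of the
  signs.\<close>

lemma circ_det_double:
  assumes m: "odd m"
  shows "circ_det (2 * m) c
    = circ_det m (\<lambda>t. c t + c (t + m)) * circ_det m (\<lambda>t. (- 1) ^ t * (c t - c (t + m)))"
proof -
  have m0: "m > 0" using m by (cases m) auto
  have "of_int (circ_det (2 * m) c) = (\<Prod>u\<in>roots_of_unity m.
      (\<Sum>t<2 * m. of_int (c t) * u ^ t) * (\<Sum>t<2 * m. of_int (c t) * (- u) ^ t))"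
    using m0 by (simp add: of_int_circ_det prod_roots_of_unity_double[OF m])
  also have "\<dots> = (\<Prod>u\<in>roots_of_unity m. (\<Sum>t<m. of_int (c t + c (t + m)) * u ^ t) *
      (\<Sum>t<m. of_int ((- 1) ^ t * (c t - c (t + m))) * u ^ t))"
  proof (intro prod.cong refl arg_cong2[where f = "(*)"])
    fix u :: complex assume "u \<in> roots_of_unity m"
    then have u: "u ^ m = 1" by simp
    show "(\<Sum>t<2 * m. of_int (c t) * u ^ t) = (\<Sum>t<m. of_int (c t + c (t + m)) * u ^ t)"
      unfolding sum_lessThan_double using u
      by (intro sum.cong refl) (simp add: power_add distrib_right)
    have um: "(- u) ^ m = - 1" using u m by simp
    have "of_int (c t) * (- u) ^ t + of_int (c (t + m)) * (- u) ^ (t + m)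
        = of_int ((- 1) ^ t * (c t - c (t + m))) * u ^ t" for t
      unfolding power_add um by (simp add: power_minus[of u t] algebra_simps)
    then show "(\<Sum>t<2 * m. of_int (c t) * (- u) ^ t)
        = (\<Sum>t<m. of_int ((- 1) ^ t * (c t - c (t + m))) * u ^ t)"
      unfolding sum_lessThan_double by (rule sum.cong[OF refl])
  qed
  also have "\<dots> = of_int (circ_det m (\<lambda>t. c t + c (t + m)) * circ_det m (\<lambda>t. (- 1) ^ t * (c t - c (t + m))))"
    by (simp only: prod.distrib of_int_mult of_int_circ_det[OF m0])
  finally show ?thesis by (simp only: of_int_eq_iff)
qed

lemma circ_det_twice_prime:
  assumes p: "prime p" "odd p" and c: "D = circ_det (2 * p) c"
  shows "2 dvd D \<longrightarrow> 4 dvd D" "int p dvd D \<longrightarrow> (int p)\<^sup>2 dvd D"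
proof -
  let ?a = "circ_det p (\<lambda>t. c t + c (t + p))"
  let ?b = "circ_det p (\<lambda>t. (- 1) ^ t * (c t - c (t + p)))"
  have D: "D = ?a * ?b" unfolding c by (rule circ_det_double[OF p(2)])
  have "[c t + c (t + p) = (- 1) ^ t * (c t - c (t + p))] (mod 2)" for t
    by (cases "even t") (simp_all add: cong_iff_dvd_diff)
  then have "[?a = ?b] (mod 2)"
    unfolding circ_det_def circulant_def by (intro sdet_cong_mod)
  then have "2 dvd ?a \<longleftrightarrow> 2 dvd ?b" by (rule cong_dvd_iff)
  moreover have "2 * 2 dvd ?a * ?b" if "2 dvd ?a" "2 dvd ?b" using that by (rule mult_dvd_mono)
  ultimately show "2 dvd D \<longrightarrow> 4 dvd D" unfolding D by auto
  show "int p dvd D \<longrightarrow> (int p)\<^sup>2 dvd D"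
  proof
    assume "int p dvd D"
    moreover have "prime (int p)" using p by simp
    ultimately have "int p dvd ?a \<or> int p dvd ?b" unfolding D using prime_dvd_mult_iff by blast
    then show "(int p)\<^sup>2 dvd D"
      unfolding D using prime_square_dvd_circ_det[OF p(1)] by (meson dvd_mult dvd_mult2)
  qed
qed

section \<open>Realizing determinants by circulants of order 26\<close>

lemma of_int_circ_minor_double:
  assumes m: "odd m"
  shows "of_int (circ_minor (2 * m) c) = (let f = \<lambda>w. \<Sum>t<2 * m. of_int (c t) * w ^ t
    in f (- 1) * (\<Prod>u\<in>roots_of_unity m - {1}. f u * f (- u)))"
proof -
  let ?f = "\<lambda>w. \<Sum>t<2 * m. of_int (c t) * w ^ t :: complex"
  \<comment> \<open>Setting the value at 1 to 1 extends the product to all roots of unity, where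
    \<open>prod_roots_of_unity_double\<close> applies.\<close>
  let ?g = "\<lambda>w. if w = 1 then 1 else ?f w"
  have m0: "m > 0" using m by (cases m) auto
  have "(\<Prod>w\<in>roots_of_unity (2 * m) - {1}. ?f w) = (\<Prod>w\<in>roots_of_unity (2 * m) - {1}. ?g w)"
    by (intro prod.cong) auto
  also have "\<dots> = (\<Prod>w\<in>roots_of_unity (2 * m). ?g w)"
    using m0 by (subst prod.remove[of "roots_of_unity (2 * m)" 1]) auto
  also have "\<dots> = (\<Prod>u\<in>roots_of_unity m. ?g u * ?g (- u))"
    by (rule prod_roots_of_unity_double[OF m])
  also have "\<dots> = ?g 1 * ?g (- 1) * (\<Prod>u\<in>roots_of_unity m - {1}. ?g u * ?g (- u))"
    using m0 by (subst prod.remove[of "roots_of_unity m" 1]) auto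
  also have "(\<Prod>u\<in>roots_of_unity m - {1}. ?g u * ?g (- u)) = (\<Prod>u\<in>roots_of_unity m - {1}. ?f u * ?f (- u))"
  proof (rule prod.cong[OF refl])
    fix u assume u: "u \<in> roots_of_unity m - {1}"
    have "- u \<noteq> 1"
    proof
      assume "- u = 1"
      then have "u = - 1" by (metis minus_minus)
      then show False using u m by simp
    qed
    then show "?g u * ?g (- u) = ?f u * ?f (- u)" using u by simp
  qed
  finally show ?thesis using m0 unfolding Let_def by (simp add: of_int_circ_minor)
qed

section \<open>Products of cyclotomic units over roots of unity\<close>

lemma prod_roots_of_unity_power:
  assumes n: "n > 0" and a: "coprime a n"
  shows "(\<Prod>u\<in>roots_of_unity n - {1}. h (u ^ a)) = (\<Prod>u\<in>roots_of_unity n - {1}. h u)"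
proof -
  obtain b where b: "[a * b = 1] (mod n)" using cong_solve_coprime_nat[OF a] by auto
  have inv: "(u ^ a) ^ b = u" if "u ^ n = 1" for u :: complex
  proof -
    have "(u ^ a) ^ b = u ^ (a * b mod n)" using that by (simp add: power_mod_eq power_mult)
    also have "a * b mod n = 1 mod n" using b by (simp add: cong_def)
    also have "u ^ (1 mod n) = u" using power_mod_eq[OF that, of 1] by (simp only: power_one_right)
    finally show ?thesis .
  qed
  have root: "(u ^ k) ^ n = 1" if "u ^ n = 1" for u :: complex and k
    using that by (metis mult.commute power_mult power_one)
  have swap: "(u ^ b) ^ a = (u ^ a) ^ b" for u :: complex by (metis mult.commute power_mult)
  show ?thesis
  proof (rule prod.reindex_bij_witness[of _ "\<lambda>u. u ^ b" "\<lambda>u. u ^ a"])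
    fix u assume u: "u \<in> roots_of_unity n - {1}"
    then show "(u ^ a) ^ b = u" "(u ^ b) ^ a = u" using inv swap by auto
    show "u ^ a \<in> roots_of_unity n - {1}" using u root inv[of u] by auto
    show "u ^ b \<in> roots_of_unity n - {1}" using u root inv[of u] swap[of u] by auto
  qed simp
qed

lemma prod_one_minus_power:
  assumes "n > 0" "coprime a n"
  shows "(\<Prod>u\<in>roots_of_unity n - {1}. 1 - u ^ a) = of_nat n"
  using prod_roots_of_unity_power[OF assms, of "\<lambda>u. 1 - u"] prod_roots_of_unity_linear[OF assms(1)] by simp

text \<open>Here \<open>1 + u^a\<close> is the quotient of \<open>1 - u^(2a)\<close> by
  \<open>1 - u^a\<close>, and both products equal \<open>n\<close>.\<close>

lemma prod_one_plus_power:
  assumes n: "odd n" and a: "coprime a n"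
  shows "(\<Prod>u\<in>roots_of_unity n - {1}. 1 + u ^ a) = 1"
proof -
  have n0: "n > 0" using n by (cases n) auto
  have "(\<Prod>u\<in>roots_of_unity n - {1}. 1 + u ^ a) * of_nat n
      = (\<Prod>u\<in>roots_of_unity n - {1}. (1 + u ^ a) * (1 - u ^ a))"
    unfolding prod.distrib prod_one_minus_power[OF n0 a] ..
  also have "\<dots> = (\<Prod>u\<in>roots_of_unity n - {1}. 1 - u ^ (a * 2))"
    by (intro prod.cong refl) (simp add: algebra_simps power_mult power2_eq_square)
  also have "\<dots> = of_nat n" using n a by (intro prod_one_minus_power n0) simp
  finally show ?thesis using n0 by simp
qed

text \<open>Away from 1 this is the cyclotomic unit \<open>(1 - w^r) / (1 - w)\<close>, while its
  value at 1 is \<open>r\<close>.\<close>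

abbreviation geom :: "nat \<Rightarrow> complex \<Rightarrow> complex" where
  "geom r w \<equiv> \<Sum>t<r. w ^ t"

lemma geom_mult: "(1 - w) * geom r w = 1 - w ^ r"
  by (rule one_diff_power_eq[symmetric])

lemma prod_geom:
  assumes n: "n > 0" and r: "coprime r n"
  shows "(\<Prod>u\<in>roots_of_unity n - {1}. geom r u) = 1"
proof -
  have "(\<Prod>u\<in>roots_of_unity n - {1}. (1 - u ^ 1) * geom r u) = of_nat n"
    unfolding power_one_right geom_mult by (rule prod_one_minus_power[OF n r])
  then show ?thesis unfolding prod.distrib using n by (subst (asm) prod_one_minus_power) auto
qed

text \<open>For odd \<open>r\<close> the value at \<open>- u\<close> is
  \<open>(1 + u^r) / (1 + u)\<close>, and both products are 1.\<close>

lemma prod_geom_uminus: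
  assumes n: "odd n" and r: "coprime r n" "odd r"
  shows "(\<Prod>u\<in>roots_of_unity n - {1}. geom r (- u)) = 1"
proof -
  have "(\<Prod>u\<in>roots_of_unity n - {1}. (1 + u ^ 1) * geom r (- u)) = (\<Prod>u\<in>roots_of_unity n - {1}. 1 + u ^ r)"
    using geom_mult[of "- _" r] r(2) by (intro prod.cong refl) simp
  also have "\<dots> = 1" by (rule prod_one_plus_power[OF n r(1)])
  finally show ?thesis
    unfolding prod.distrib prod_one_plus_power[OF n coprime_1_left] by simp
qed

lemma geom_minus_one: "odd r \<Longrightarrow> geom r (- 1) = 1"
  using geom_mult[of "- 1" r] by simp

lemma root_polys_id: "n > 0 \<Longrightarrow> (\<lambda>w. w) \<in> root_polys n"
  using root_polys_monom[of n 1 1] by simp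

lemma root_polys_const: "n > 0 \<Longrightarrow> (\<lambda>_. of_int k) \<in> root_polys n"
  using root_polys_monom[of n k 0] by simp

lemma root_polys_geom: "n > 0 \<Longrightarrow> f \<in> root_polys n \<Longrightarrow> (\<lambda>w. geom r (f w)) \<in> root_polys n"
  by (intro root_polys_sum root_polys_power)

lemma root_polys_one_minus: "n > 0 \<Longrightarrow> f \<in> root_polys n \<Longrightarrow> (\<lambda>w. 1 - f w) \<in> root_polys n"
  using root_polys_add[OF root_polys_const[of n 1] root_polys_mult[OF _ root_polys_const[of n "- 1"], of f]]
  by simp

lemma root_polys_one_plus: "n > 0 \<Longrightarrow> f \<in> root_polys n \<Longrightarrow> (\<lambda>w. 1 + f w) \<in> root_polys n"
  using root_polys_add[OF root_polys_const[of n 1], of f] by simp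

text \<open>The free integer \<open>h\<close> lets the first factor run through a residue class
  modulo \<open>2 * m\<close> while the minor stays fixed.\<close>

lemma circulant_of_values:
  assumes m: "odd m" and g: "g \<in> root_polys (2 * m)"
    and s: "g 1 = of_int s" and minus: "g (- 1) = of_int e"
    and R: "(\<Prod>u\<in>roots_of_unity m - {1}. g u) = of_int R"
    and R': "(\<Prod>u\<in>roots_of_unity m - {1}. g (- u)) = of_int R'"
  shows "\<exists>c. circ_det (2 * m) c = (s + 2 * int m * h) * (e * R * R') \<and> circ_minor (2 * m) c = e * R * R'"
proof -
  have m0: "2 * m > 0" using m by (cases m) auto
  obtain c0 :: "nat \<Rightarrow> int" where c0: "\<forall>w. w ^ (2 * m) = 1 \<longrightarrow> g w = (\<Sum>t<2 * m. of_int (c0 t) * w ^ t)"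
    using g by (rule root_polysE)
  let ?c = "\<lambda>t. c0 t + h"
  have val: "(\<Sum>t<2 * m. of_int (?c t) * w ^ t) = g w + of_int h * (if w = 1 then of_nat (2 * m) else 0)"
    if "w ^ (2 * m) = 1" for w :: complex
    using c0[rule_format, OF that]
    by (simp add: distrib_right sum.distrib sum_powers_root_of_unity[OF that] flip: sum_distrib_left)
  have root: "u ^ (2 * m) = 1" "(- u) ^ (2 * m) = 1" "- u \<noteq> 1" if "u ^ m = 1" for u :: complex
  proof -
    show "u ^ (2 * m) = 1" using that by (simp add: mult.commute[of 2] power_mult)
    then show "(- u) ^ (2 * m) = 1" by simp
    show "- u \<noteq> 1"
    proof
      assume "- u = 1"
      then have "u = - 1" by (metis minus_minus)
      then show False using that m by simp
    qed
  qed
  have "of_int (circ_minor (2 * m) ?c) = g (- 1) * (\<Prod>u\<in>roots_of_unity m - {1}. g u * g (- u))"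
    unfolding of_int_circ_minor_double[OF m] Let_def
  proof (intro arg_cong2[where f = "(*)"] prod.cong refl)
    show "(\<Sum>t<2 * m. of_int (?c t) * (- 1) ^ t) = g (- 1)" by (subst val) simp_all
  next
    fix u assume u: "u \<in> roots_of_unity m - {1}"
    then show "(\<Sum>t<2 * m. of_int (?c t) * u ^ t) = g u" using root by (subst val) auto
    show "(\<Sum>t<2 * m. of_int (?c t) * (- u) ^ t) = g (- u)" using u root by (subst val) auto
  qed
  also have "\<dots> = of_int (e * R * R')" unfolding prod.distrib R R' minus by simp
  finally have minor: "circ_minor (2 * m) ?c = e * R * R'" by (simp only: of_int_eq_iff)
  have "of_int (\<Sum>t<2 * m. ?c t) = (of_int (s + 2 * int m * h) :: complex)"
    using val[of 1] s by simp
  then have "(\<Sum>t<2 * m. ?c t) = s + 2 * int m * h" by (simp only: of_int_eq_iff)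
  with minor show ?thesis using circ_det_eq[OF m0, of ?c] by metis
qed

lemma circulant26_of_values:
  assumes "g \<in> root_polys 26" "g 1 = of_int s" "g (- 1) = of_int e"
    "(\<Prod>u\<in>roots_of_unity 13 - {1}. g u) = of_int R"
    "(\<Prod>u\<in>roots_of_unity 13 - {1}. g (- u)) = of_int R'"
    and A: "A = (s + 26 * h) * (e * R * R')" and R: "\<not> 3 dvd e * R * R'"
  shows "\<exists>c. circ_det 26 c = A \<and> \<not> 3 dvd circ_minor 26 c"
  using circulant_of_values[of 13 g s e R R' h] assms by auto

lemma prime_13: "prime (13 :: nat)" by simp

lemma coprime_13: "\<not> 13 dvd r \<Longrightarrow> coprime r (13 :: nat)"
  using prime_imp_coprime[OF prime_13] coprime_commute by blast

text \<open>Adding \<open>h\<close> to all coefficients only changes the value at 1. The remaining values below are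
  cyclotomic units and prime elements.\<close>

lemma circulant26_coprime_13:
  fixes r :: nat
  assumes r: "odd r" "\<not> 13 dvd r"
  shows "\<exists>c. circ_det 26 c = int r + 26 * h \<and> \<not> 3 dvd circ_minor 26 c"
    and "\<exists>c. circ_det 26 c = 4 * (int r + 13 * h) \<and> \<not> 3 dvd circ_minor 26 c"
proof -
  have P: "(\<Prod>u\<in>roots_of_unity 13 - {1}. geom r u) = 1"
    using r by (intro prod_geom coprime_13) auto
  have P': "(\<Prod>u\<in>roots_of_unity 13 - {1}. geom r (- u)) = 1"
    using r by (intro prod_geom_uminus coprime_13) auto
  have Q: "(\<Prod>u\<in>roots_of_unity 13 - {1}. 1 + u ^ 2) = 1"
    by (intro prod_one_plus_power coprime_13) auto
  show "\<exists>c. circ_det 26 c = int r + 26 * h \<and> \<not> 3 dvd circ_minor 26 c"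
    by (rule circulant26_of_values[where g = "geom r" and s = "int r" and e = 1 and R = 1 and R' = 1 and h = h])
       (use r P P' root_polys_geom[OF _ root_polys_id, of 26 r] in \<open>auto simp: geom_minus_one\<close>)
  \<comment> \<open>The factor \<open>1 + w^2\<close> has the value 2 at both 1 and -1, and its
    product over the nontrivial 13th roots of unity and over their negatives is 1: hence the
    4.\<close>
  show "\<exists>c. circ_det 26 c = 4 * (int r + 13 * h) \<and> \<not> 3 dvd circ_minor 26 c"
  proof (rule circulant26_of_values[where g = "\<lambda>w. (1 + w ^ 2) * geom r w" and s = "2 * int r"
        and e = 2 and R = 1 and R' = 1 and h = h])
    show "(\<lambda>w. (1 + w ^ 2) * geom r w) \<in> root_polys 26"
      by (intro root_polys_mult root_polys_one_plus root_polys_geom root_polys_power root_polys_id) simp_all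
    show "(\<Prod>u\<in>roots_of_unity 13 - {1}. (1 + u ^ 2) * geom r u) = of_int 1"
      unfolding prod.distrib P Q by simp
    show "(\<Prod>u\<in>roots_of_unity 13 - {1}. (1 + (- u) ^ 2) * geom r (- u)) = of_int 1"
      unfolding prod.distrib P' power2_minus Q by simp
  qed (use r in \<open>auto simp: geom_minus_one\<close>)
qed

text \<open>The polynomial \<open>1 - w\<close> is unsuitable here, having the even value 2 at -1.
  The argument \<open>w ^ 14\<close> takes the same value \<open>u\<close> at \<open>u\<close> and
  \<open>- u\<close>, so the first term becomes \<open>1 - u^6\<close> and \<open>(1 + u)\<close>
  times a unit. The second term lives only at 1 and -1, where it adds 13 and -13. The length 6 is
  chosen so that the value at -1 is 12 - 13 = -1.\<close>

lemma circulant26_odd_169: "\<exists>c. circ_det 26 c = - 169 * (1 + 2 * h) \<and> \<not> 3 dvd circ_minor 26 c"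
proof (rule circulant26_of_values[where g = "\<lambda>w. (1 - w) * geom 6 (w ^ 14) + w * geom 13 (w ^ 2)"
      and s = 13 and e = "- 1" and R = 13 and R' = 1 and h = h])
  let ?g = "\<lambda>w. (1 - w) * geom 6 (w ^ 14) + w * geom 13 (w ^ 2)"
  show "?g \<in> root_polys 26"
    by (intro root_polys_add root_polys_mult root_polys_one_minus root_polys_geom root_polys_power root_polys_id)
      simp_all
  show "?g 1 = of_int 13" "?g (- 1) = of_int (- 1)" by simp_all
  have vals: "?g u = 1 - u ^ 6" "?g (- u) = (1 + u ^ 1) * geom 6 u" if "u \<in> roots_of_unity 13 - {1}" for u
  proof -
    have u: "u ^ 13 = 1" "u \<noteq> 1" using that by auto
    have u14: "u ^ 14 = u" using u(1) power_Suc[of u 13] by simp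
    have "u ^ 2 \<noteq> 1"
    proof
      assume "u ^ 2 = 1"
      then have "(u ^ 2) ^ 7 = 1" by simp
      then have "u ^ 14 = 1" by (simp flip: power_mult)
      then show False using u14 u(2) by simp
    qed
    moreover have "(u ^ 2) ^ 13 = 1" using u(1) by (metis mult.commute power_mult power_one)
    ultimately have zero: "geom 13 (u ^ 2) = 0" by (simp only: sum_powers_root_of_unity if_False)
    have "(- u) ^ 14 = u" using u14 by (simp add: power_minus_even)
    then show "?g (- u) = (1 + u ^ 1) * geom 6 u" using zero by (simp only: power2_minus) simp
    show "?g u = 1 - u ^ 6" unfolding u14 zero geom_mult by simp
  qed
  have "(\<Prod>u\<in>roots_of_unity 13 - {1}. ?g u) = (\<Prod>u\<in>roots_of_unity 13 - {1}. 1 - u ^ 6)"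
    by (intro prod.cong refl vals)
  also have "\<dots> = of_int 13" by (subst prod_one_minus_power) (auto intro: coprime_13)
  finally show "(\<Prod>u\<in>roots_of_unity 13 - {1}. ?g u) = of_int 13" .
  have "(\<Prod>u\<in>roots_of_unity 13 - {1}. ?g (- u)) = (\<Prod>u\<in>roots_of_unity 13 - {1}. (1 + u ^ 1) * geom 6 u)"
    by (intro prod.cong refl vals)
  also have "\<dots> = of_int 1"
    unfolding prod.distrib by (subst prod_one_plus_power, simp, simp, subst prod_geom) (auto intro: coprime_13)
  finally show "(\<Prod>u\<in>roots_of_unity 13 - {1}. ?g (- u)) = of_int 1" .
qed simp_all

text \<open>The value of \<open>1 - w\<close> at 1 is 0 and becomes \<open>26 * h\<close> after the
  shift; the remaining values multiply to 26.\<close>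

lemma circulant26_multiple_676: "\<exists>c. circ_det 26 c = 676 * h \<and> \<not> 3 dvd circ_minor 26 c"
proof (rule circulant26_of_values[where g = "\<lambda>w. 1 - w" and s = 0 and e = 2 and R = 13 and R' = 1 and h = h])
  show "(\<lambda>w. 1 - w) \<in> root_polys 26"
    by (intro root_polys_one_minus root_polys_id) simp_all
  show "(\<Prod>u\<in>roots_of_unity 13 - {1}. 1 - u) = of_int 13"
    using prod_one_minus_power[of 13 1] by simp
  show "(\<Prod>u\<in>roots_of_unity 13 - {1}. 1 - - u) = of_int 1"
    using prod_one_plus_power[of 13 1] by simp
qed simp_all

lemma circulant26_realization:
  fixes A :: int
  assumes A: "2 dvd A \<longrightarrow> 4 dvd A" "13 dvd A \<longrightarrow> 13\<^sup>2 dvd A"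
  obtains c where "circ_det 26 c = A" "\<not> 3 dvd circ_minor 26 c"
proof -
  have "\<exists>c. circ_det 26 c = A \<and> \<not> 3 dvd circ_minor 26 c"
  proof (cases "13 dvd A")
    case d13: False
    show ?thesis
    proof (cases "2 dvd A")
      case True
      then obtain k where k: "A = 4 * k" using A by auto
      \<comment> \<open>An odd \<open>r\<close> is needed for the value 1 at -1; an even residue is
        raised by 13 and \<open>h\<close> is lowered by 1 to compensate.\<close>
      define r where "r = nat (if odd (k mod 13) then k mod 13 else k mod 13 + 13)"
      define h where "h = (if odd (k mod 13) then k div 13 else k div 13 - 1)"
      have "k mod 13 \<ge> 0" by simp
      then have r: "int r = (if odd (k mod 13) then k mod 13 else k mod 13 + 13)"
        unfolding r_def by simp
      have h: "int r + 13 * h = k"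
        unfolding r h_def using mult_div_mod_eq[of 13 k] by auto
      have "odd (int r)" unfolding r by simp
      then have "odd r" by simp
      moreover have "\<not> 13 dvd r"
      proof
        assume "13 dvd r"
        then have "13 dvd int r" using int_dvd_int_iff[of 13 r] by simp
        then have "13 dvd k" using h by (metis dvd_add dvd_triv_left)
        then show False using d13 k by simp
      qed
      ultimately show ?thesis using circulant26_coprime_13(2)[of r h] h k by simp
    next
      case False
      define r where "r = nat (A mod 26)"
      have r: "int r = A mod 26" by (simp add: r_def)
      then have h: "int r + 26 * (A div 26) = A" by simp
      have "odd (int r)" using False dvd_mod_iff[of 2 26 A] unfolding r by simp
      then have "odd r" by simp
      moreover have "\<not> 13 dvd r"
      proof
        assume "13 dvd r"
        then have "13 dvd A mod 26" using int_dvd_int_iff[of 13 r] unfolding r[symmetric] by simp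
        then show False using d13 dvd_mod_iff[of 13 26 A] by simp
      qed
      ultimately show ?thesis using circulant26_coprime_13(1)[of r "A div 26"] h by simp
    qed
  next
    case True
    then obtain k where k: "A = 169 * k" using A by auto
    show ?thesis
    proof (cases "2 dvd A")
      case True
      then have "4 dvd A" using A by simp
      moreover have "A = 4 * (42 * k) + k" using k by simp
      ultimately have "4 dvd k" using dvd_add_right_iff[of 4 "4 * (42 * k)" k] by simp
      then obtain j where "k = 4 * j" ..
      then show ?thesis using circulant26_multiple_676[of j] k by simp
    next
      case False
      then have "odd k" unfolding k by simp
      then obtain j where "k = 2 * j + 1" by (elim oddE)
      \<comment> \<open>The sign of the minor -13 forces this shift:
        \<open>1 + 2 * (- j - 1) = - (2 * j + 1)\<close>.\<close>
      then show ?thesis using circulant26_odd_169[of "- j - 1"] k by (simp add: algebra_simps)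
    qed
  qed
  then show thesis using that by blast
qed

section \<open>The integer group determinants of GA(1,27)\<close>

theorem theorem6:
  assumes "card (UNIV :: 'a::{field, finite} set) = 27"
  shows "integer_group_determinants (GA1 :: ('a \<times> 'a) monoid) =
    {D. \<exists>A B :: int. D = A * B ^ 26 \<and> [B = A] (mod 27) \<and>
        (2 dvd A \<longrightarrow> 4 dvd A) \<and> (13 dvd A \<longrightarrow> 13\<^sup>2 dvd A)}"
proof -
  obtain \<psi> :: "'a \<Rightarrow> complex" where "nontrivial_character \<psi> 27"
    using nontrivial_character_exists[OF assms] by blast
  then interpret nontrivial_character \<psi> 27 .
  obtain \<gamma> :: 'a where \<gamma>: "\<gamma> \<noteq> 0" "\<gamma> ^ 26 = 1" and bij: "bij_betw (\<lambda>i. \<gamma> ^ i) {..<26 :: nat} X"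
    using primitive_root_exists[OF assms] by blast
  \<comment> \<open>Numbering the nonzero elements by exponents of \<open>\<gamma>\<close> turns
    division into \<open>cyc_diff\<close>, hence matrices in \<open>a / c\<close> into
    circulants.\<close>
  have quotient: "\<gamma> ^ i / \<gamma> ^ j = \<gamma> ^ cyc_diff 26 i j" if "j < 26" for i j
  proof -
    have "\<gamma> ^ cyc_diff 26 i j * \<gamma> ^ j = \<gamma> ^ (i + (26 - j)) * \<gamma> ^ j"
      unfolding cyc_diff_def by (simp only: power_mod_eq[OF \<gamma>(2)])
    also have "\<dots> = \<gamma> ^ i * \<gamma> ^ 26" using that by (simp flip: power_add)
    finally show ?thesis using \<gamma> by (simp add: field_simps)
  qed
  have sdet_eq_circ: "sdet X (\<lambda>a c. g (a / c)) = circ_det 26 (\<lambda>t. g (\<gamma> ^ t))" for g :: "'a \<Rightarrow> int"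
    unfolding sdet_reindex[OF bij finite_lessThan] circ_det_def
    by (rule sdet_cong) (simp add: quotient circulant_def)
  show ?thesis
  proof (rule equalityI; rule subsetI)
    fix D assume "D \<in> integer_group_determinants (GA1 :: ('a \<times> 'a) monoid)"
    then obtain f where f: "D = group_det (GA1 :: ('a \<times> 'a) monoid) f"
      by (auto simp: integer_group_determinants_def)
    define A where "A = sdet X (\<lambda>a c. \<Sum>b\<in>UNIV. f (a / c, b))"
    obtain k where "sdet X (K f 1) = of_int (A - int 27 * k)"
      unfolding A_def by (rule sdet_K_congruence)
    then have "D = A * (A - 27 * k) ^ 26"
      using group_det_GA1_factorization[of "A - 27 * k" f] unfolding f A_def by simp
    moreover have "[A - 27 * k = A] (mod 27)" by (simp add: cong_iff_dvd_diff)
    moreover have "A = circ_det (2 * 13) (\<lambda>t. \<Sum>b\<in>UNIV. f (\<gamma> ^ t, b))"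
      unfolding A_def using sdet_eq_circ[of "\<lambda>h. \<Sum>b\<in>UNIV. f (h, b)"] by simp
    then have "2 dvd A \<longrightarrow> 4 dvd A" "13 dvd A \<longrightarrow> 13\<^sup>2 dvd A"
      using circ_det_twice_prime[OF prime_13, of A] by simp_all
    ultimately show "D \<in> {D. \<exists>A B :: int. D = A * B ^ 26 \<and> [B = A] (mod 27) \<and>
        (2 dvd A \<longrightarrow> 4 dvd A) \<and> (13 dvd A \<longrightarrow> 13\<^sup>2 dvd A)}" by blast
  next
    fix D assume "D \<in> {D. \<exists>A B :: int. D = A * B ^ 26 \<and> [B = A] (mod 27) \<and>
        (2 dvd A \<longrightarrow> 4 dvd A) \<and> (13 dvd A \<longrightarrow> 13\<^sup>2 dvd A)}"
    then obtain A B :: int where D: "D = A * B ^ 26" and AB: "[B = A] (mod 27)"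
      and A: "2 dvd A \<longrightarrow> 4 dvd A" "13 dvd A \<longrightarrow> 13\<^sup>2 dvd A" by blast
    obtain c where c: "circ_det 26 c = A" "\<not> 3 dvd circ_minor 26 c"
      using A by (rule circulant26_realization)
    \<comment> \<open>The discrete logarithm to base \<open>\<gamma>\<close>.\<close>
    define l where "l = inv_into {..<26 :: nat} (\<lambda>i. \<gamma> ^ i)"
    have l: "l (\<gamma> ^ i) = i" if "i < 26" for i
      unfolding l_def using bij that by (intro inv_into_f_f) (auto simp: bij_betw_def)
    define g where "g h = c (l h)" for h
    have "det_full (3 ^ 3) {..<26} (circulant 26 c)"
      using c(2) by (intro det_full_circulant) simp_all
    moreover have "[B = sdet {..<26} (circulant 26 c)] (mod 3 ^ 3)"
      using AB c(1) by (simp add: circ_det_def)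
    ultimately obtain T where T: "\<forall>i\<in>{..<26}. \<forall>j\<in>{..<26}. [T i j = circulant 26 c i j] (mod 3 ^ 3)"
      and B: "sdet {..<26} T = B" by (rule det_fullE)
    \<comment> \<open>On the indices that occur the division by 27 is exact, by the congruence for
      \<open>T\<close>.\<close>
    define E where "E a d = (T (l a) (l d) - g (a / d)) div 27" for a d
    obtain f where f: "\<And>h. h \<noteq> 0 \<Longrightarrow> (\<Sum>b\<in>UNIV. f (h, b)) = g h"
      and fB: "sdet X (K f 1) = of_int (sdet X (\<lambda>a d. g (a / d) + int 27 * E a d))"
      by (rule realize_congruent_matrix[of g E]) blast
    have "sdet X (\<lambda>a d. g (a / d) + int 27 * E a d) = sdet {..<26} T"
      unfolding sdet_reindex[OF bij finite_lessThan]
    proof (rule sdet_cong)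
      fix i j :: nat assume ij: "i \<in> {..<26}" "j \<in> {..<26}"
      then have "g (\<gamma> ^ i / \<gamma> ^ j) = circulant 26 c i j"
        by (simp add: quotient g_def l circulant_def)
      moreover have "27 dvd T i j - circulant 26 c i j"
        using T ij by (simp add: cong_iff_dvd_diff)
      ultimately show "g (\<gamma> ^ i / \<gamma> ^ j) + int 27 * E (\<gamma> ^ i) (\<gamma> ^ j) = T i j"
        using ij by (simp add: E_def l)
    qed
    then have "of_int B = sdet X (K f 1)" using fB B by simp
    then have "group_det (GA1 :: ('a \<times> 'a) monoid) f
        = sdet X (\<lambda>a c. \<Sum>b\<in>UNIV. f (a / c, b)) * B ^ 26"
      using group_det_GA1_factorization by simp
    also have "sdet X (\<lambda>a c. \<Sum>b\<in>UNIV. f (a / c, b)) = sdet X (\<lambda>a c. g (a / c))"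
      by (rule sdet_cong) (simp add: f)
    also have "\<dots> = circ_det 26 c"
      unfolding sdet_eq_circ circ_det_def
      by (rule sdet_cong) (simp add: circulant_def g_def l)
    finally show "D \<in> integer_group_determinants (GA1 :: ('a \<times> 'a) monoid)"
      unfolding D c(1) integer_group_determinants_def by (intro CollectI exI) (rule sym)
  qed
qed

end
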